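(* Let $G$ be a subgroup of $\mathbb{Q}^d$ for some integer $d\ge 1$, let $R$ be a Noetherian $G$-graded ring and $M$ a finitely generated $G$-graded $R$-module. Then: (1) $M$ is modest if and only if the ring $(R/\operatorname{ann} M)_0$ is Artinian; (2) when $M$ is modest, the Hilbert series (Hilbert function) of $M$ is summable.
   Context: All rings are commutative with identity. A $G$-graded ring is $R=\bigoplus_{g\in G}R_g$ with $R_gR_h\subset R_{g+h}$; a $G$-graded $R$-module is $M=\bigoplus_{g\in G}M_g$ with $R_gM_h\subset M_{g+h}$. $\ell_{R_0}$ denotes length as an $R_0$-module. $M$ is modest if $\ell_{R_0}(M_g)<\infty$ for every $g\in G$. The annihilator $\operatorname{ann}M$ is a homogeneous ideal, so $R/\operatorname{ann}M$ is $G$-graded, and $(R/\operatorname{ann}M)_0$ is its degree-$0$ part (the zero ring counts as Artinian). Let $\mathbb{Z}[\mathbb{Q}^d]$ be the ring of finite sums $\sum_{t\in\mathbb{Q}^d}a_tz^t$ with $a_t\in\mathbb{Z}$, $z^t=z_1^{t_1}\cdots z_d^{t_d}$, and let $\mathbb{Z}[[\mathbb{Q}^d]]$ be the additive group of all formal (possibly infinite) sums $\sum_{t\in\mathbb{Q}^d}a_tz^t$, $a_t\in\mathbb{Z}$; it is a module over $\mathbb{Z}[\mathbb{Q}^d]$, in particular over $\mathbb{Z}[z,z^{-1}]=\mathbb{Z}[z_1^{\pm1},\ldots,z_d^{\pm1}]$. The Hilbert series of a modest module $M$ is $HS(z)=\sum_{t\in\mathbb{Q}^d}\ell_{R_0}(M_t)z^t\in\mathbb{Z}[[\mathbb{Q}^d]]$,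 where $M_t=0$ for $t\notin G$. An element $a(z)\in\mathbb{Z}[[\mathbb{Q}^d]]$ is summable if there exists a nonzero $b(z)\in\mathbb{Z}[z,z^{-1}]$ with $a(z)b(z)\in\mathbb{Z}[\mathbb{Q}^d]$. *)

theory Defs
  imports
    "HOL-Analysis.Finite_Cartesian_Product"
    "HOL-Library.Poly_Mapping"
    "HOL-Library.Extended_Nat"
    "HOL-Algebra.Algebra"
begin

section \<open>Graded rings and modules\<close>

definition is_subgroup :: "'g::ab_group_add set \<Rightarrow> bool"
  where "is_subgroup G \<longleftrightarrow> 0 \<in> G \<and> (\<forall>g\<in>G. \<forall>h\<in>G. g + h \<in> G) \<and> (\<forall>g\<in>G. - g \<in> G)"

text \<open>
  Gradings are internal: a grading is a family of subsets of the carrier, of which only the members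
  with index in \<open>G\<close> matter.  A family of components of an element is extended by zero outside
  \<open>G\<close>, so that it is determined by the element.
\<close>

definition component_families :: "'g set \<Rightarrow> ('b, 'm) ring_scheme \<Rightarrow> ('g \<Rightarrow> 'b set) \<Rightarrow> ('g \<Rightarrow> 'b) set"
  where "component_families G A Ac =
    {f. (\<forall>g\<in>G. f g \<in> Ac g) \<and> (\<forall>g. g \<notin> G \<longrightarrow> f g = \<zero>\<^bsub>A\<^esub>) \<and> finite {g. f g \<noteq> \<zero>\<^bsub>A\<^esub>}}"

definition is_direct_sum :: "'g set \<Rightarrow> ('b, 'm) ring_scheme \<Rightarrow> ('g \<Rightarrow> 'b set) \<Rightarrow> bool"
  where "is_direct_sum G A Ac \<longleftrightarrow>
    (\<forall>g\<in>G. additive_subgroup (Ac g) A) \<and>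
    (\<forall>x\<in>carrier A. \<exists>!f. f \<in> component_families G A Ac \<and> x = finsum A f {g. f g \<noteq> \<zero>\<^bsub>A\<^esub>})"

locale graded_ring = cring R
  for G :: "'g::ab_group_add set" and R :: "('a, 'm) ring_scheme" (structure) and Rc :: "'g \<Rightarrow> 'a set" +
  assumes ring_direct_sum: "is_direct_sum G R Rc"
    and ring_mult_degree: "\<lbrakk>g \<in> G; h \<in> G; a \<in> Rc g; b \<in> Rc h\<rbrakk> \<Longrightarrow> a \<otimes> b \<in> Rc (g + h)"

locale graded_module = graded_ring G R Rc + Module.module R M
  for G :: "'g::ab_group_add set" and R :: "('a, 'm) ring_scheme" (structure) and Rc :: "'g \<Rightarrow> 'a set"
    and M :: "('a, 'b, 'n) module_scheme" (structure) and Mc :: "'g \<Rightarrow> 'b set" +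
  assumes module_direct_sum: "is_direct_sum G M Mc"
    and smult_degree: "\<lbrakk>g \<in> G; h \<in> G; a \<in> Rc g; x \<in> Mc h\<rbrakk> \<Longrightarrow> a \<odot>\<^bsub>M\<^esub> x \<in> Mc (g + h)"

definition finitely_generated_module :: "('a, 'm) ring_scheme \<Rightarrow> ('a, 'b, 'n) module_scheme \<Rightarrow> bool"
  where "finitely_generated_module R M \<longleftrightarrow>
    (\<exists>S\<subseteq>carrier M. finite S \<and> carrier M = \<Inter>{N. submodule N R M \<and> S \<subseteq> N})"


section \<open>Length, modest modules, Artinian rings\<close>

definition module_length :: "('a, 'm) ring_scheme \<Rightarrow> ('a, 'b, 'n) module_scheme \<Rightarrow> enat"
  where "module_length R M =
    (SUP n \<in> {n. \<exists>N::nat \<Rightarrow> 'b set. (\<forall>i\<le>n. submodule (N i) R M) \<and> (\<forall>i<n. N i \<subset> N (Suc i))}. enat n)"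

definition graded_length ::
    "('a, 'm) ring_scheme \<Rightarrow> ('g::zero \<Rightarrow> 'a set) \<Rightarrow> ('a, 'b, 'n) module_scheme \<Rightarrow> ('g \<Rightarrow> 'b set) \<Rightarrow> 'g \<Rightarrow> enat"
  where "graded_length R Rc M Mc g = module_length (R\<lparr>carrier := Rc 0\<rparr>) (M\<lparr>carrier := Mc g\<rparr>)"

definition modest ::
    "'g::zero set \<Rightarrow> ('a, 'm) ring_scheme \<Rightarrow> ('g \<Rightarrow> 'a set) \<Rightarrow> ('a, 'b, 'n) module_scheme \<Rightarrow> ('g \<Rightarrow> 'b set) \<Rightarrow> bool"
  where "modest G R Rc M Mc \<longleftrightarrow> (\<forall>g\<in>G. graded_length R Rc M Mc g < \<infinity>)"

definition ann :: "('a, 'm) ring_scheme \<Rightarrow> ('a, 'b, 'n) module_scheme \<Rightarrow> 'a set"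
  where "ann R M = {r \<in> carrier R. \<forall>x\<in>carrier M. r \<odot>\<^bsub>M\<^esub> x = \<zero>\<^bsub>M\<^esub>}"

text \<open>The grading induced on \<open>R/I\<close> for a homogeneous ideal \<open>I\<close>: degree \<open>g\<close> is the image of \<open>R\<^sub>g\<close>.\<close>

definition quotient_grading :: "('a, 'm) ring_scheme \<Rightarrow> 'a set \<Rightarrow> ('g \<Rightarrow> 'a set) \<Rightarrow> 'g \<Rightarrow> 'a set set"
  where "quotient_grading R I Rc g = (\<lambda>r. I +>\<^bsub>R\<^esub> r) ` Rc g"

text \<open>The zero ring is allowed.\<close>

locale artinian_ring = cring +
  assumes descending_chain_condition:
    "\<lbrakk>\<And>n::nat. ideal (I n) R; \<And>n. I (Suc n) \<subseteq> I n\<rbrakk> \<Longrightarrow> \<exists>m. \<forall>n\<ge>m. I n = I m"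


section \<open>Formal series with exponents in \<open>\<rat>\<^sup>d\<close>\<close>

text \<open>
  The ring of finite sums with exponents in \<open>\<rat>\<^sup>d\<close> is \<^typ>\<open>(rat ^ 'd) \<Rightarrow>\<^sub>0 int\<close> with its convolution
  product; the additive group of formal series is \<^typ>\<open>rat ^ 'd \<Rightarrow> int\<close>.
\<close>

definition laurent_polynomials :: "((rat ^ 'd) \<Rightarrow>\<^sub>0 int) set"
  where "laurent_polynomials = {b. \<forall>t\<in>Poly_Mapping.keys b. \<forall>i. t $ i \<in> \<int>}"

definition series_act :: "((rat ^ 'd) \<Rightarrow>\<^sub>0 int) \<Rightarrow> (rat ^ 'd \<Rightarrow> int) \<Rightarrow> (rat ^ 'd \<Rightarrow> int)"
  where "series_act b a = (\<lambda>t. \<Sum>s\<in>Poly_Mapping.keys b. Poly_Mapping.lookup b s * a (t - s))"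

definition summable_series :: "(rat ^ 'd \<Rightarrow> int) \<Rightarrow> bool"
  where "summable_series a \<longleftrightarrow>
    (\<exists>b\<in>laurent_polynomials. b \<noteq> 0 \<and> (\<exists>c::(rat ^ 'd) \<Rightarrow>\<^sub>0 int. series_act b a = Poly_Mapping.lookup c))"

text \<open>Only meaningful for modest modules, where all the lengths are finite.\<close>

definition hilbert_series ::
    "(rat ^ 'd) set \<Rightarrow> ('a, 'm) ring_scheme \<Rightarrow> (rat ^ 'd \<Rightarrow> 'a set) \<Rightarrow>
     ('a, 'b, 'n) module_scheme \<Rightarrow> (rat ^ 'd \<Rightarrow> 'b set) \<Rightarrow> (rat ^ 'd \<Rightarrow> int)"
  where "hilbert_series G R Rc M Mc =
    (\<lambda>t. if t \<in> G then int (the_enat (graded_length R Rc M Mc t)) else 0)"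

end

theory Submission
  imports Defs
begin

text \<open>
  Extending the gradings by zero outside \<open>G\<close>, we may grade by all of \<open>\<rat>\<^sup>d\<close>.  Everything is expressed
  through homogeneous submodules, given as families of their degree parts; they satisfy the
  ascending chain condition, and hence so do the \<open>R\<^sub>0\<close>-submodules of each \<open>M\<^sub>t\<close>.

  (1) If \<open>M\<close> is modest with homogeneous generators \<open>x\<^sub>1, \<dots>, x\<^sub>k\<close>, then \<open>(R/ann M)\<^sub>0\<close> embeds into
  the sum of the components containing the \<open>x\<^sub>i\<close>, so it has finite length.  Conversely, an Artinian
  \<open>(R/ann M)\<^sub>0\<close> has finite length over \<open>R\<^sub>0\<close>, and each \<open>M\<^sub>t\<close> is a finitely generated module over it.

  (2) By Noetherian induction on a homogeneous ideal \<open>J\<close>, the Hilbert series of every subquotient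
  \<open>N/N'\<close> killed by \<open>J\<close> is summable.  Such a subquotient has a filtration whose steps are cyclic with
  a prime annihilator \<open>P\<close>.  If some \<open>f \<notin> P\<close> has degree \<open>g \<noteq> 0\<close>, multiplication by \<open>f\<close> is injective on
  the step, so \<open>(1 - z\<^sup>g)\<close> times its series is the series of a module killed by a larger ideal;
  otherwise the step is concentrated in one degree.
\<close>

section \<open>Chain conditions and heights of ordered sets\<close>

text \<open>The usual proof for Hilbert series inducts on homogeneous algebra generators over R_0.
  Here \<open>G\<close> need not be finitely generated and no such generators are sought; Noetherian
  induction on ideals asks only for a chain condition. Nothing makes degrees positive either, so a
  series may extend in all directions: for k[x, 1/x] over a field k, with x in degree 1, it is the
  sum of all z^n, which 1 - z annihilates. Hence one multiplies by Laurent polynomials and never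
  inverts them. Quotient modules are never formed. A subquotient is a pair of nested families of
  degree parts, and its length in degree t is the height of the ordered set of R_0-submodules
  between the two parts. Additivity of length thereby becomes a statement about intersections and
  sums with a fixed submodule. Prime annihilators matter because on a cyclic module (L + Rx)/L with
  such an annihilator every homogeneous f that does not kill the generator acts injectively, so one
  multiplication compares two degrees exactly.\<close>

definition acc :: "'x::order set \<Rightarrow> bool"
  where "acc S \<longleftrightarrow> wf {(y, x). x \<in> S \<and> y \<in> S \<and> x < y}"

definition dcc :: "'x::order set \<Rightarrow> bool"
  where "dcc S \<longleftrightarrow> wf {(y, x). x \<in> S \<and> y \<in> S \<and> y < x}"

lemma acc_maximal:
  assumes "acc S" "T \<subseteq> S" "T \<noteq> {}"
  shows "\<exists>m\<in>T. \<forall>x\<in>T. \<not> m < x"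
proof -
  obtain t where t: "t \<in> T" using assms(3) by blast
  obtain m where "m \<in> T" "\<forall>y. (y, m) \<in> {(y, x). x \<in> S \<and> y \<in> S \<and> x < y} \<longrightarrow> y \<notin> T"
    using assms(1)[unfolded acc_def wf_eq_minimal, rule_format, OF t] by auto
  with assms(2) show ?thesis by (intro bexI[of _ m]) auto
qed

lemma dcc_minimal:
  assumes "dcc S" "T \<subseteq> S" "T \<noteq> {}"
  shows "\<exists>m\<in>T. \<forall>x\<in>T. \<not> x < m"
proof -
  obtain t where t: "t \<in> T" using assms(3) by blast
  obtain m where "m \<in> T" "\<forall>y. (y, m) \<in> {(y, x). x \<in> S \<and> y \<in> S \<and> y < x} \<longrightarrow> y \<notin> T"
    using assms(1)[unfolded dcc_def wf_eq_minimal, rule_format, OF t] by auto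
  with assms(2) show ?thesis by (intro bexI[of _ m]) auto
qed

text \<open>Pulls a well-founded relation back along \<open>f\<close>. Only strict monotonicity
  matters, so ordered sets of different kinds can be compared: families of degree parts with ideals,
  or submodules of one component with homogeneous submodules.\<close>

lemma acc_strict_mono_image:
  assumes "acc T" "\<And>x. x \<in> S \<Longrightarrow> f x \<in> T" "\<And>x y. x \<in> S \<Longrightarrow> y \<in> S \<Longrightarrow> x < y \<Longrightarrow> f x < f y"
  shows "acc S"
  unfolding acc_def
  by (rule wf_subset[OF wf_inv_image[OF assms(1)[unfolded acc_def], of f]])
    (use assms(2,3) in \<open>auto simp: inv_image_def\<close>)

lemma acc_subset: "acc T \<Longrightarrow> S \<subseteq> T \<Longrightarrow> acc S"
  by (rule acc_strict_mono_image[of T S id]) auto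

text \<open>Serves the argument that a module is Noetherian when a submodule and the quotient by it
  are: a strict step that leaves \<open>f\<close> unchanged must raise \<open>g\<close>, so the
  pairs climb in the lexicographic order.\<close>

lemma acc_lex_image:
  assumes "acc T" "acc U" "\<And>x. x \<in> S \<Longrightarrow> f x \<in> T" "\<And>x. x \<in> S \<Longrightarrow> g x \<in> U"
    and "\<And>x y. x \<in> S \<Longrightarrow> y \<in> S \<Longrightarrow> x < y \<Longrightarrow> f x < f y \<or> f x = f y \<and> g x < g y"
  shows "acc S"
  unfolding acc_def
  by (rule wf_subset[OF wf_inv_image[OF wf_lex_prod[OF assms(1,2)[unfolded acc_def]], of "\<lambda>x. (f x, g x)"]])
    (use assms(3-5) in \<open>fastforce simp: inv_image_def\<close>)

lemma dccI:
  assumes "\<And>f :: nat \<Rightarrow> 'x::order. (\<And>i. f i \<in> S) \<Longrightarrow> (\<And>i. f (Suc i) < f i) \<Longrightarrow> False"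
  shows "dcc S"
  unfolding dcc_def wf_iff_no_infinite_down_chain using assms by blast

lemma accI:
  assumes "\<And>f :: nat \<Rightarrow> 'x::order. (\<And>i. f i \<in> S) \<Longrightarrow> (\<And>i. f i < f (Suc i)) \<Longrightarrow> False"
  shows "acc S"
  unfolding acc_def wf_iff_no_infinite_down_chain using assms by blast

lemma acc_singleton:
  assumes "S \<subseteq> {a}"
  shows "acc S"
proof (rule accI)
  fix f assume f: "\<And>i. f i \<in> S" "\<And>i. f i < f (Suc i)"
  have "f 0 = a" "f (Suc 0) = a" using f(1) assms by blast+
  then show False using f(2)[of 0] by simp
qed

lemma dcc_stabilizes:
  fixes f :: "nat \<Rightarrow> 'x::order"
  assumes "dcc S" "\<And>i. f i \<in> S" "\<And>i. f (Suc i) \<le> f i"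
  shows "\<exists>m. \<forall>n\<ge>m. f n = f m"
proof -
  have dec: "f j \<le> f i" if "i \<le> j" for i j
    using lift_Suc_antimono_le[of f, OF assms(3) that] .
  obtain y where y: "y \<in> range f" "\<And>x. x \<in> range f \<Longrightarrow> \<not> x < y"
    using dcc_minimal[OF assms(1), of "range f"] assms(2) by blast
  then obtain m where "y = f m" by blast
  then have "f n = f m" if "n \<ge> m" for n
    using y(2)[of "f n"] dec[OF that] by (simp add: order_less_le)
  then show ?thesis by blast
qed

section \<open>Heights of ordered sets, the order-theoretic form of length\<close>

definition finite_chain :: "'x::order set \<Rightarrow> bool"
  where "finite_chain C \<longleftrightarrow> finite C \<and> (\<forall>x\<in>C. \<forall>y\<in>C. x \<le> y \<or> y \<le> x)"

text \<open>Counts steps of chains, not elements. On the submodules between two given ones it is the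
  length of the quotient. By truncated subtraction the empty chain contributes 0.\<close>

definition height :: "'x::order set \<Rightarrow> enat"
  where "height S = (SUP C\<in>{C. finite_chain C \<and> C \<subseteq> S}. enat (card C - 1))"

lemma finite_chain_subset: "finite_chain C \<Longrightarrow> D \<subseteq> C \<Longrightarrow> finite_chain D"
  unfolding finite_chain_def by (meson finite_subset subsetD)

lemma finite_chain_image:
  assumes "finite_chain C" "\<And>x y. x \<in> C \<Longrightarrow> y \<in> C \<Longrightarrow> x \<le> y \<Longrightarrow> f x \<le> f y"
  shows "finite_chain (f ` C)"
  using assms unfolding finite_chain_def by (metis (no_types, lifting) finite_imageI imageE)

lemma finite_chain_greatest:
  assumes "finite_chain C" "C \<noteq> {}"
  obtains m where "m \<in> C" "\<And>x. x \<in> C \<Longrightarrow> x \<le> m"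
proof -
  from assms obtain m where "m \<in> C" "\<And>x. x \<in> C \<Longrightarrow> m \<le> x \<Longrightarrow> m = x"
    unfolding finite_chain_def using finite_has_maximal by metis
  with assms show thesis unfolding finite_chain_def by (metis that)
qed

lemma finite_chain_induct [consumes 1, case_names empty insert]:
  assumes "finite_chain C" "P {}"
    and "\<And>m C. finite_chain (insert m C) \<Longrightarrow> m \<notin> C \<Longrightarrow> (\<And>x. x \<in> C \<Longrightarrow> x < m) \<Longrightarrow> P C \<Longrightarrow> P (insert m C)"
  shows "P C"
  using assms(1)
proof (induction "card C" arbitrary: C)
  case 0
  then show ?case using assms(2) by (simp add: finite_chain_def)
next
  case (Suc n)
  then have "C \<noteq> {}" by auto
  then obtain m where m: "m \<in> C" "\<And>x. x \<in> C \<Longrightarrow> x \<le> m"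
    using finite_chain_greatest Suc.prems by blast
  then have "P (C - {m})"
    using Suc finite_chain_subset[of C "C - {m}"] by simp
  moreover have "C = insert m (C - {m})" using m by blast
  ultimately show ?case
    using assms(3)[of m "C - {m}"] Suc.prems m by (metis DiffE insertI1 order_le_less)
qed

lemma height_le_iff:
  "height S \<le> enat k \<longleftrightarrow> (\<forall>C. finite_chain C \<and> C \<subseteq> S \<longrightarrow> card C \<le> Suc k)"
  unfolding height_def by (auto simp: SUP_le_iff le_diff_conv)

lemma height_ge: "finite_chain C \<Longrightarrow> C \<subseteq> S \<Longrightarrow> enat (card C - 1) \<le> height S"
  unfolding height_def by (auto intro: SUP_upper)

text \<open>A finite supremum of natural numbers is a maximum. If the empty chain attains it, a
  singleton does too; choosing \<open>C\<close> nonempty keeps the later count of elements free of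
  truncation.\<close>

lemma height_attained:
  assumes "S \<noteq> {}" "height S < \<infinity>"
  obtains C where "finite_chain C" "C \<subseteq> S" "C \<noteq> {}" "height S = enat (card C - 1)"
proof -
  let ?H = "{C. finite_chain C \<and> C \<subseteq> S}"
  have "{} \<in> ?H" by (simp add: finite_chain_def)
  then have "(\<lambda>C. enat (card C - 1)) ` ?H \<noteq> {}" by blast
  moreover have fin: "finite ((\<lambda>C. enat (card C - 1)) ` ?H)"
    using assms(2) height_def[of S] by (metis Sup_enat_def \<open>(\<lambda>C. enat (card C - 1)) ` ?H \<noteq> {}\<close> less_irrefl)
  ultimately have "height S \<in> (\<lambda>C. enat (card C - 1)) ` ?H"
    unfolding height_def Sup_enat_def using Max_in by (metis (no_types, lifting))
  then obtain C where C: "finite_chain C" "C \<subseteq> S" "height S = enat (card C - 1)" by blast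
  obtain s where "s \<in> S" using assms(1) by blast
  show thesis
  proof (cases "C = {}")
    case True
    then show thesis using C \<open>s \<in> S\<close> by (intro that[of "{s}"]) (auto simp: finite_chain_def)
  next
    case False
    then show thesis using C that by blast
  qed
qed

lemma height_le_image:
  assumes "\<And>x. x \<in> S \<Longrightarrow> f x \<in> T" "\<And>x y. x \<in> S \<Longrightarrow> y \<in> S \<Longrightarrow> x \<le> y \<Longrightarrow> f x \<le> f y" "inj_on f S"
  shows "height S \<le> height T"
  unfolding height_def[of S]
proof (rule SUP_least)
  fix C assume "C \<in> {C. finite_chain C \<and> C \<subseteq> S}"
  then have C: "finite_chain C" "C \<subseteq> S" by auto
  then have "finite_chain (f ` C)" using assms(2) by (intro finite_chain_image) blast+
  moreover have "card (f ` C) = card C" by (meson C(2) assms(3) card_image inj_on_subset)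
  moreover have "f ` C \<subseteq> T" using C assms(1) by blast
  ultimately show "enat (card C - 1) \<le> height T" using height_ge by metis
qed

lemma height_mono: "S \<subseteq> T \<Longrightarrow> height S \<le> height T"
  by (rule height_le_image[of S id]) auto

text \<open>Each step up the chain strictly raises \<open>f\<close> or \<open>g\<close>. A chain
  with n steps thus shows n new values besides the two initial ones, n + 2 in all, while it has n +
  1 elements itself.\<close>

lemma card_chain_le_joint_images:
  fixes f :: "'x::order \<Rightarrow> 'y::order" and g :: "'x \<Rightarrow> 'z::order"
  assumes "finite_chain C" "C \<noteq> {}"
    and "\<And>x y. x \<in> C \<Longrightarrow> y \<in> C \<Longrightarrow> x \<le> y \<Longrightarrow> f x \<le> f y" "\<And>x y. x \<in> C \<Longrightarrow> y \<in> C \<Longrightarrow> x \<le> y \<Longrightarrow> g x \<le> g y"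
    and "\<And>x y. x \<in> C \<Longrightarrow> y \<in> C \<Longrightarrow> x \<le> y \<Longrightarrow> f x = f y \<Longrightarrow> g x = g y \<Longrightarrow> x = y"
  shows "card C + 1 \<le> card (f ` C) + card (g ` C)"
  using assms
proof (induction C rule: finite_chain_induct)
  case empty
  then show ?case by simp
next
  case (insert m C)
  have fin: "finite C" using insert.hyps(1) by (simp add: finite_chain_def)
  show ?case
  proof (cases "C = {}")
    case True
    then show ?thesis by simp
  next
    case False
    then have IH: "card C + 1 \<le> card (f ` C) + card (g ` C)"
      using insert.IH insert.prems by simp
    \<comment> \<open>It is enough to compare \<open>m\<close> with the previous greatest element:
      by monotonicity a value at \<open>m\<close> that has occurred before would have to be the
      value at \<open>x\<close>.\<close>
    obtain x where x: "x \<in> C" "\<And>y. y \<in> C \<Longrightarrow> y \<le> x"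
      using finite_chain_greatest[of C] False finite_chain_subset insert.hyps(1) by blast
    have xm: "x \<le> m" using insert.hyps(3)[OF x(1)] by (rule order.strict_implies_order)
    have "f x \<noteq> f m \<or> g x \<noteq> g m"
      using insert.prems(4)[of x m] xm x(1) insert.hyps(2) by auto
    moreover have "f m \<notin> f ` C" if "f x \<noteq> f m"
    proof
      assume "f m \<in> f ` C"
      then obtain y where "y \<in> C" "f m = f y" by auto
      then have "f m \<le> f x" using insert.prems(2)[of y x] x by simp
      then show False using insert.prems(2)[of x m] xm x(1) that by simp
    qed
    moreover have "g m \<notin> g ` C" if "g x \<noteq> g m"
    proof
      assume "g m \<in> g ` C"
      then obtain y where "y \<in> C" "g m = g y" by auto
      then have "g m \<le> g x" using insert.prems(3)[of y x] x by simp
      then show False using insert.prems(3)[of x m] xm x(1) that by simp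
    qed
    ultimately show ?thesis
      using IH fin insert.hyps(2) by (auto simp: card_insert_if)
  qed
qed

text \<open>The counting behind the additivity of length. For submodules, \<open>f\<close> and
  \<open>g\<close> are intersection with \<open>b\<close> and sum with \<open>b\<close>, and the
  last hypothesis is the modular law. Projecting a chain to both sides of \<open>b\<close> gives one
  inequality, joining a chain below \<open>b\<close> to one above \<open>b\<close> gives the
  other.\<close>

lemma height_additive:
  assumes b: "b \<in> S"
    and f: "\<And>x. x \<in> S \<Longrightarrow> f x \<in> S \<and> f x \<le> b" "\<And>x y. x \<in> S \<Longrightarrow> y \<in> S \<Longrightarrow> x \<le> y \<Longrightarrow> f x \<le> f y"
    and g: "\<And>x. x \<in> S \<Longrightarrow> g x \<in> S \<and> b \<le> g x" "\<And>x y. x \<in> S \<Longrightarrow> y \<in> S \<Longrightarrow> x \<le> y \<Longrightarrow> g x \<le> g y"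
    and fg: "\<And>x y. x \<in> S \<Longrightarrow> y \<in> S \<Longrightarrow> x \<le> y \<Longrightarrow> f x = f y \<Longrightarrow> g x = g y \<Longrightarrow> x = y"
  shows "height S = height {x\<in>S. x \<le> b} + height {x\<in>S. b \<le> x}"
proof (rule antisym)
  let ?L = "{x\<in>S. x \<le> b}" and ?U = "{x\<in>S. b \<le> x}"
  show "height S \<le> height ?L + height ?U"
    unfolding height_def[of S]
  proof (rule SUP_least)
    fix C assume "C \<in> {C. finite_chain C \<and> C \<subseteq> S}"
    then have C: "finite_chain C" "C \<subseteq> S" by auto
    have mono: "\<And>x y. x \<in> C \<Longrightarrow> y \<in> C \<Longrightarrow> x \<le> y \<Longrightarrow> f x \<le> f y"
      "\<And>x y. x \<in> C \<Longrightarrow> y \<in> C \<Longrightarrow> x \<le> y \<Longrightarrow> g x \<le> g y" using C f(2) g(2) by blast+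
    show "enat (card C - 1) \<le> height ?L + height ?U"
    proof (cases "C = {}")
      case False
      have "card C + 1 \<le> card (f ` C) + card (g ` C)"
        by (rule card_chain_le_joint_images[OF C(1) False mono]) (use C fg in blast)+
      moreover have "0 < card (f ` C)" "0 < card (g ` C)"
        using False C(1) by (auto simp: card_gt_0_iff finite_chain_def)
      ultimately have "enat (card C - 1) \<le> enat (card (f ` C) - 1) + enat (card (g ` C) - 1)"
        by simp
      also have "\<dots> \<le> height ?L + height ?U"
        using C f(1) g(1) mono by (intro add_mono height_ge finite_chain_image) auto
      finally show ?thesis .
    qed (simp add: zero_enat_def[symmetric])
  qed
  show "height ?L + height ?U \<le> height S"
  proof (cases "height ?L < \<infinity> \<and> height ?U < \<infinity>")
    case False
    then show ?thesis
      using height_mono[of ?L S] height_mono[of ?U S] by (auto simp: subset_iff)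
  next
    case True
    have ne: "?L \<noteq> {}" "?U \<noteq> {}" using b by auto
    obtain C where C: "finite_chain C" "C \<subseteq> ?L" "C \<noteq> {}" "height ?L = enat (card C - 1)"
      using height_attained[OF ne(1)] True by blast
    obtain D where D: "finite_chain D" "D \<subseteq> ?U" "D \<noteq> {}" "height ?U = enat (card D - 1)"
      using height_attained[OF ne(2)] True by blast
    have fin: "finite C" "finite D" using C D by (auto simp: finite_chain_def)
    have "x \<le> y" if "x \<in> C" "y \<in> D" for x y
    proof (rule order_trans)
      show "x \<le> b" using that C(2) by blast
      show "b \<le> y" using that D(2) by blast
    qed
    then have chain: "finite_chain (C \<union> D)"
      using C(1) D(1) unfolding finite_chain_def by blast
    \<comment> \<open>The two chains share at most \<open>b\<close>, so the union loses at most one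
      element; this is the one that counting steps instead of elements allows for.\<close>
    have "C \<inter> D \<subseteq> {b}" using C(2) D(2) by (auto intro: antisym)
    then have "card (C \<inter> D) \<le> 1"
      using card_mono[of "{b}" "C \<inter> D"] by simp
    then have "card C + card D - 1 \<le> card (C \<union> D)"
      using card_Un_Int[OF fin] by simp
    then have "card C - 1 + (card D - 1) \<le> card (C \<union> D) - 1"
      using C(3) D(3) fin card_gt_0_iff[of C] card_gt_0_iff[of D] by linarith
    then have "height ?L + height ?U \<le> enat (card (C \<union> D) - 1)" using C(4) D(4) by simp
    also have "\<dots> \<le> height S" using C(2) D(2) chain by (intro height_ge) auto
    finally show ?thesis .
  qed
qed

lemma height_finite_imp_dcc:
  fixes S :: "'x::order set"
  assumes "height S < \<infinity>"
  shows "dcc S"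
proof (rule dccI)
  fix f :: "nat \<Rightarrow> 'x" assume f: "\<And>i. f i \<in> S" "\<And>i. f (Suc i) < f i"
  have dec: "f j < f i" if "i < j" for i j
    using that by (induction j) (use f(2) in \<open>auto simp: less_Suc_eq intro: less_trans\<close>)
  obtain k where "height S = enat k" using assms by auto
  then have bound: "\<And>C. finite_chain C \<Longrightarrow> C \<subseteq> S \<Longrightarrow> card C \<le> Suc k" using height_le_iff[of S k] by auto
  have "inj f" using dec by (metis injI linorder_neqE_nat order_less_irrefl)
  then have "card (f ` {..Suc k}) = Suc (Suc k)" by (simp add: card_image inj_on_subset)
  moreover have "finite_chain (f ` {..Suc k})"
    using dec unfolding finite_chain_def by (auto) (metis linorder_neqE_nat order.strict_implies_order order_refl)
  ultimately show False using bound[of "f ` {..Suc k}"] f(1) by auto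
qed

lemma height_subset_pair:
  assumes "S \<subseteq> {a, b}"
  shows "height S \<le> 1"
  unfolding one_enat_def height_le_iff
proof (intro allI impI)
  fix C assume "finite_chain C \<and> C \<subseteq> S"
  then have "C \<subseteq> {a, b}" using assms by blast
  then have "card C \<le> card {a, b}" by (intro card_mono) auto
  also have "\<dots> \<le> 2" by (simp add: card_insert_if)
  finally show "card C \<le> Suc 1" by simp
qed

lemma height_singleton:
  assumes "S \<subseteq> {a}"
  shows "height S = 0"
proof -
  have "height S \<le> enat 0"
    unfolding height_le_iff
  proof (intro allI impI)
    fix C assume "finite_chain C \<and> C \<subseteq> S"
    then have "C \<subseteq> {a}" using assms by blast
    then have "card C \<le> card {a}" by (intro card_mono) auto
    then show "card C \<le> Suc 0" by simp
  qed
  then show ?thesis by (simp add: zero_enat_def[symmetric])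
qed

lemma finite_chain_sequence:
  assumes "finite_chain C" "card C = Suc n"
  shows "\<exists>f::nat \<Rightarrow> 'x::order. f ` {..n} = C \<and> (\<forall>i<n. f i < f (Suc i))"
  using assms
proof (induction C arbitrary: n rule: finite_chain_induct)
  case empty
  then show ?case by simp
next
  case (insert m C)
  have fin: "finite C" using insert.hyps(1) by (simp add: finite_chain_def)
  then have n: "card C = n" using insert.prems insert.hyps(2) by simp
  show ?case
  proof (cases n)
    case 0
    then show ?thesis using n fin by (intro exI[of _ "\<lambda>_. m"]) auto
  next
    case (Suc k)
    then obtain f where f: "f ` {..k} = C" "\<forall>i<k. f i < f (Suc i)"
      using insert.IH n by blast
    let ?f = "f(n := m)"
    have "?f ` {..n} = insert m (f ` {..k})"
      using Suc by (auto simp: atMost_Suc image_iff le_Suc_eq)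
    moreover have "?f i < ?f (Suc i)" if "i < n" for i
      using that f Suc insert.hyps(3)[of "f k"] by (auto simp: less_Suc_eq)
    ultimately show ?thesis using f(1) by metis
  qed
qed

text \<open>Matches the shape of \<open>module_length\<close>, where n is the number of strict
  inclusions in a sequence of n + 1 submodules.\<close>

lemma height_eq_SUP_sequences:
  fixes S :: "'x::order set"
  assumes "S \<noteq> {}"
  shows "height S = (SUP n\<in>{n. \<exists>f::nat \<Rightarrow> 'x. (\<forall>i\<le>n. f i \<in> S) \<and> (\<forall>i<n. f i < f (Suc i))}. enat n)"
    (is "_ = (SUP n\<in>?N. enat n)")
proof (rule antisym)
  obtain s where s: "s \<in> S" using assms by blast
  show "height S \<le> (SUP n\<in>?N. enat n)"
    unfolding height_def
  proof (rule SUP_least)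
    fix C assume "C \<in> {C. finite_chain C \<and> C \<subseteq> S}"
    then have C: "finite_chain C" "C \<subseteq> S" by auto
    show "enat (card C - 1) \<le> (SUP n\<in>?N. enat n)"
    proof (cases "card C")
      case 0
      then show ?thesis by (simp add: zero_enat_def[symmetric])
    next
      case (Suc n)
      then obtain f where "f ` {..n} = C" "\<forall>i<n. f i < f (Suc i)" using finite_chain_sequence C by blast
      then have "n \<in> ?N" using C(2) by auto
      then show ?thesis using Suc by (auto intro: SUP_upper)
    qed
  qed
  show "(SUP n\<in>?N. enat n) \<le> height S"
  proof (rule SUP_least)
    fix n assume "n \<in> ?N"
    then obtain f :: "nat \<Rightarrow> 'x" where f: "\<forall>i\<le>n. f i \<in> S" "\<forall>i<n. f i < f (Suc i)" by blast
    have less: "f i < f j" if "i < j" "j \<le> n" for i j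
      using that
    proof (induction j)
      case (Suc j)
      then show ?case using f(2) by (cases "i = j") (auto intro: less_trans)
    qed simp
    then have "inj_on f {..n}"
      by (metis atMost_iff inj_onI linorder_neqE_nat order_less_irrefl)
    then have "card (f ` {..n}) = Suc n" by (simp add: card_image)
    moreover have "finite_chain (f ` {..n})"
      unfolding finite_chain_def using less
      by auto (metis linorder_neqE_nat order.strict_implies_order order_refl)
    ultimately show "enat n \<le> height S"
      using height_ge[of "f ` {..n}" S] f(1) by (metis atMost_iff diff_Suc_1 image_subsetI)
  qed
qed

section \<open>Homogeneous submodules\<close>

definition extend_by_zero :: "'g set \<Rightarrow> ('b, 'm) ring_scheme \<Rightarrow> ('g \<Rightarrow> 'b set) \<Rightarrow> 'g \<Rightarrow> 'b set"
  where "extend_by_zero G A Ac g = (if g \<in> G then Ac g else {\<zero>\<^bsub>A\<^esub>})"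

definition component :: "('b, 'm) ring_scheme \<Rightarrow> ('g \<Rightarrow> 'b set) \<Rightarrow> 'b \<Rightarrow> 'g \<Rightarrow> 'b"
  where "component A Ac x =
    (THE f. f \<in> component_families UNIV A Ac \<and> x = finsum A f {g. f g \<noteq> \<zero>\<^bsub>A\<^esub>})"

text \<open>Component families vanish outside \<open>G\<close> by definition, so both gradings have
  literally the same families; what remains is that the zero subgroup is a legitimate
  component.\<close>

lemma is_direct_sum_extend_by_zero:
  assumes "abelian_group A" "is_direct_sum G A Ac"
  shows "is_direct_sum UNIV A (extend_by_zero G A Ac)"
proof -
  interpret abelian_group A by fact
  have "additive_subgroup {\<zero>\<^bsub>A\<^esub>} A"
    using add.triv_subgroup by (intro additive_subgroupI) simp
  moreover have "component_families UNIV A (extend_by_zero G A Ac) = component_families G A Ac"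
    by (auto simp: component_families_def extend_by_zero_def split: if_splits)
  ultimately show ?thesis
    using assms(2) by (auto simp: is_direct_sum_def extend_by_zero_def)
qed

locale full_direct_sum = abelian_group A for A :: "('b, 'm) ring_scheme" (structure) +
  fixes Ac :: "'g \<Rightarrow> 'b set"
  assumes direct_sum: "is_direct_sum UNIV A Ac"
begin

lemma Ac_subgroup: "additive_subgroup (Ac t) A"
  using direct_sum by (simp add: is_direct_sum_def)

lemma Ac_closed: "x \<in> Ac t \<Longrightarrow> x \<in> carrier A"
  using additive_subgroup.a_Hcarr[OF Ac_subgroup] .

lemma zero_in_Ac: "\<zero> \<in> Ac t"
  using additive_subgroup.zero_closed[OF Ac_subgroup] .

lemma add_in_Ac: "x \<in> Ac t \<Longrightarrow> y \<in> Ac t \<Longrightarrow> x \<oplus> y \<in> Ac t"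
  using additive_subgroup.a_closed[OF Ac_subgroup] .

lemma component_family:
  assumes "x \<in> carrier A"
  shows "component A Ac x \<in> component_families UNIV A Ac"
    and "x = finsum A (component A Ac x) {g. component A Ac x g \<noteq> \<zero>}"
proof -
  have "\<exists>!f. f \<in> component_families UNIV A Ac \<and> x = finsum A f {g. f g \<noteq> \<zero>}"
    using direct_sum assms by (simp add: is_direct_sum_def)
  from theI'[OF this] show "component A Ac x \<in> component_families UNIV A Ac"
    and "x = finsum A (component A Ac x) {g. component A Ac x g \<noteq> \<zero>}"
    unfolding component_def by auto
qed

lemma component_mem: "x \<in> carrier A \<Longrightarrow> component A Ac x t \<in> Ac t"
  using component_family(1) by (auto simp: component_families_def)

lemma component_closed: "x \<in> carrier A \<Longrightarrow> component A Ac x t \<in> carrier A"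
  using component_mem Ac_closed by blast

lemma finite_components: "x \<in> carrier A \<Longrightarrow> finite {t. component A Ac x t \<noteq> \<zero>}"
  using component_family(1) by (auto simp: component_families_def)

text \<open>The finite set \<open>S\<close> may exceed the support of \<open>f\<close>. With this
  freedom two elements can be expanded over a common index set, where supports may shrink by
  cancellation.\<close>

lemma component_unique:
  assumes "finite S" "\<And>t. f t \<in> Ac t" "\<And>t. t \<notin> S \<Longrightarrow> f t = \<zero>" "x = finsum A f S"
  shows "component A Ac x = f"
proof -
  have sub: "{t. f t \<noteq> \<zero>} \<subseteq> S" using assms(3) by blast
  have "x = finsum A f {t. f t \<noteq> \<zero>}"
    unfolding assms(4)
    by (rule add.finprod_mono_neutral_cong_right) (use assms(1,3) sub Ac_closed[OF assms(2)] in auto)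
  moreover have "f \<in> component_families UNIV A Ac"
    using assms(1,2) sub by (auto simp: component_families_def intro: finite_subset)
  moreover have "x \<in> carrier A" unfolding assms(4) using Ac_closed[OF assms(2)] by (intro finsum_closed) auto
  ultimately show ?thesis
    using direct_sum component_family[of x] unfolding is_direct_sum_def by blast
qed

lemma component_add:
  assumes "x \<in> carrier A" "y \<in> carrier A"
  shows "component A Ac (x \<oplus> y) t = component A Ac x t \<oplus> component A Ac y t"
proof -
  let ?f = "component A Ac x" and ?g = "component A Ac y"
  let ?S = "{t. ?f t \<noteq> \<zero>} \<union> {t. ?g t \<noteq> \<zero>}"
  have fin: "finite ?S" using finite_components assms by simp
  have "x = finsum A ?f ?S"
    by (subst component_family(2)[OF assms(1)], rule add.finprod_mono_neutral_cong_left)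
      (use fin component_closed assms in auto)
  moreover have "y = finsum A ?g ?S"
    by (subst component_family(2)[OF assms(2)], rule add.finprod_mono_neutral_cong_left)
      (use fin component_closed assms in auto)
  ultimately have "x \<oplus> y = finsum A (\<lambda>t. ?f t \<oplus> ?g t) ?S"
    using finsum_addf[of ?f ?S ?g] component_closed assms by (auto simp: Pi_def)
  then have "component A Ac (x \<oplus> y) = (\<lambda>t. ?f t \<oplus> ?g t)"
    by (intro component_unique[OF fin]) (auto intro: add_in_Ac component_mem assms)
  then show ?thesis by simp
qed

lemma component_homogeneous:
  assumes "x \<in> Ac s"
  shows "component A Ac x t = (if t = s then x else \<zero>)"
proof -
  have "component A Ac x = (\<lambda>t. if t = s then x else \<zero>)"
    by (rule component_unique[of "{s}"]) (use assms zero_in_Ac Ac_closed in auto)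
  then show ?thesis by simp
qed

text \<open>Acts as an induction rule: with \<open>S\<close> the set of elements having some
  additive property, the property need only be checked on homogeneous elements.\<close>

lemma carrier_subset_of_homogeneous:
  assumes "\<zero> \<in> S" "\<And>t x. x \<in> Ac t \<Longrightarrow> x \<in> S" "\<And>x y. x \<in> S \<Longrightarrow> y \<in> S \<Longrightarrow> x \<in> carrier A \<Longrightarrow> y \<in> carrier A \<Longrightarrow> x \<oplus> y \<in> S"
  shows "carrier A \<subseteq> S"
proof
  fix x assume x: "x \<in> carrier A"
  have "finsum A (component A Ac x) T \<in> S" if "finite T" for T
    using that
  proof (induction T)
    case (insert t T)
    then show ?case
      using assms(3)[OF assms(2)[OF component_mem[OF x]]] component_closed[OF x] by (simp add: Pi_def)
  qed (use assms(1) in simp)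
  then show "x \<in> S" using component_family(2)[OF x] finite_components[OF x] by metis
qed

end

section \<open>The ring as a graded module over itself\<close>

definition self_module :: "('a, 'm) ring_scheme \<Rightarrow> ('a, 'a) module"
  where "self_module R = \<lparr>carrier = carrier R, monoid.mult = (\<otimes>\<^bsub>R\<^esub>), one = \<one>\<^bsub>R\<^esub>,
    ring.zero = \<zero>\<^bsub>R\<^esub>, ring.add = (\<oplus>\<^bsub>R\<^esub>), smult = (\<otimes>\<^bsub>R\<^esub>)\<rparr>"

lemma self_module_simps [simp]:
  "carrier (self_module R) = carrier R" "\<zero>\<^bsub>self_module R\<^esub> = \<zero>\<^bsub>R\<^esub>"
  "(\<oplus>\<^bsub>self_module R\<^esub>) = (\<oplus>\<^bsub>R\<^esub>)" "(\<odot>\<^bsub>self_module R\<^esub>) = (\<otimes>\<^bsub>R\<^esub>)"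
  by (simp_all add: self_module_def)

lemma finsum_self_module [simp]: "finsum (self_module R) f S = finsum R f S"
  by (simp add: finsum_def finprod_def)

lemma module_self_module:
  assumes "cring R"
  shows "module R (self_module R)"
proof -
  interpret cring R by fact
  have "abelian_group (self_module R)"
    by (rule abelian_groupI) (auto simp: a_ac intro!: bexI[of _ "\<ominus>\<^bsub>R\<^esub> _"] l_neg)
  then show ?thesis
    by (intro moduleI) (auto simp: cring_axioms l_distr r_distr m_assoc)
qed

text \<open>Makes homogeneous ideals a special case of homogeneous submodules, so that every result
  about graded modules can be interpreted for the ring as well.\<close>

lemma graded_module_self_module:
  assumes "graded_ring G R Rc"
  shows "graded_module G R Rc (self_module R) Rc"
proof -
  interpret graded_ring G R Rc by fact
  interpret M: Module.module R "self_module R" by (rule module_self_module) (rule cring_axioms)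
  show ?thesis
  proof
    show "is_direct_sum G (self_module R) Rc"
      using ring_direct_sum
      by (simp add: is_direct_sum_def component_families_def additive_subgroup_def subgroup_def m_inv_def)
  qed (auto intro: ring_mult_degree)
qed

lemma acc_ideals:
  assumes "noetherian_ring R"
  shows "acc {I. ideal I R}"
proof (rule accI)
  interpret noetherian_ring R by fact
  fix f :: "nat \<Rightarrow> 'a set"
  assume f: "\<And>i. f i \<in> {I. ideal I R}" "\<And>i. f i < f (Suc i)"
  have "f i \<subseteq> f j" if "i \<le> j" for i j
    using lift_Suc_mono_le[of f, OF _ that] f(2) by (simp add: less_imp_le)
  then have "subset.chain {I. ideal I R} (range f)"
    using f(1) by (auto simp: subset_chain_def) (metis nat_le_linear subsetD)
  then have "\<Union>(range f) \<in> range f" using ideal_chain_is_trivial by blast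
  then obtain m where "\<Union>(range f) = f m" by auto
  then show False using f(2)[of m] by blast
qed

text \<open>A homogeneous submodule is stored as the family of its degree parts, ordered pointwise.
  Closure under negation comes from the scalar -1, which has degree 0.\<close>

definition homogeneous_submodule ::
    "('g::ab_group_add \<Rightarrow> 'a set) \<Rightarrow> ('a, 'b, 'n) module_scheme \<Rightarrow> ('g \<Rightarrow> 'b set) \<Rightarrow> ('g \<Rightarrow> 'b set) \<Rightarrow> bool"
  where "homogeneous_submodule Rc M Mc N \<longleftrightarrow>
    (\<forall>t. N t \<subseteq> Mc t \<and> \<zero>\<^bsub>M\<^esub> \<in> N t \<and> (\<forall>x\<in>N t. \<forall>y\<in>N t. x \<oplus>\<^bsub>M\<^esub> y \<in> N t)) \<and>
    (\<forall>g t. \<forall>r\<in>Rc g. \<forall>x\<in>N t. r \<odot>\<^bsub>M\<^esub> x \<in> N (g + t))"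

text \<open>For R_0-submodules \<open>B\<close> and \<open>C\<close> of one component these are the
  submodules of the quotient C/B, by the correspondence theorem. \<open>B\<close> and
  \<open>C\<close> are plain sets here; closure is demanded of \<open>K\<close> alone.\<close>

definition degree_submodules ::
    "('g::ab_group_add \<Rightarrow> 'a set) \<Rightarrow> ('a, 'b, 'n) module_scheme \<Rightarrow> 'b set \<Rightarrow> 'b set \<Rightarrow> 'b set set"
  where "degree_submodules Rc M B C =
    {K. B \<subseteq> K \<and> K \<subseteq> C \<and> \<zero>\<^bsub>M\<^esub> \<in> K \<and> (\<forall>x\<in>K. \<forall>y\<in>K. x \<oplus>\<^bsub>M\<^esub> y \<in> K) \<and>
      (\<forall>r\<in>Rc 0. \<forall>x\<in>K. r \<odot>\<^bsub>M\<^esub> x \<in> K)}"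

locale full_graded_module = graded_module UNIV R Rc M Mc
  for R :: "('a, 'm) ring_scheme" (structure) and Rc :: "'g::ab_group_add \<Rightarrow> 'a set"
    and M :: "('a, 'b, 'n) module_scheme" (structure) and Mc :: "'g \<Rightarrow> 'b set"
begin

sublocale RD: full_direct_sum R Rc
  by unfold_locales (rule ring_direct_sum)

sublocale MD: full_direct_sum M Mc
  by unfold_locales (rule module_direct_sum)

lemma full_graded_self_module: "full_graded_module R Rc (self_module R) Rc"
  using graded_module_self_module graded_ring_axioms by (simp add: full_graded_module_def)

lemma smult_mem: "r \<in> Rc g \<Longrightarrow> x \<in> Mc t \<Longrightarrow> r \<odot>\<^bsub>M\<^esub> x \<in> Mc (g + t)"
  by (rule smult_degree) auto

text \<open>Both sides are additive in \<open>x\<close>, and on homogeneous \<open>x\<close> both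
  are either the full product or zero.\<close>

lemma component_smult:
  assumes r: "r \<in> Rc g" and x: "x \<in> carrier M"
  shows "component M Mc (r \<odot>\<^bsub>M\<^esub> x) t = r \<odot>\<^bsub>M\<^esub> component M Mc x (t - g)"
proof -
  have rc: "r \<in> carrier R" using r RD.Ac_closed by blast
  let ?S = "{x\<in>carrier M. component M Mc (r \<odot>\<^bsub>M\<^esub> x) t = r \<odot>\<^bsub>M\<^esub> component M Mc x (t - g)}"
  have "carrier M \<subseteq> ?S"
  proof (rule MD.carrier_subset_of_homogeneous)
    show "\<zero>\<^bsub>M\<^esub> \<in> ?S"
      using rc MD.component_homogeneous[OF MD.zero_in_Ac] by simp
  next
    fix s x assume x: "x \<in> Mc s"
    then have "r \<odot>\<^bsub>M\<^esub> x \<in> Mc (g + s)" using r smult_mem by blast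
    then show "x \<in> ?S"
      using x rc MD.Ac_closed by (auto simp: MD.component_homogeneous)
  next
    fix x y assume "x \<in> ?S" "y \<in> ?S"
    then show "x \<oplus>\<^bsub>M\<^esub> y \<in> ?S"
      using rc by (simp add: smult_r_distr MD.component_add MD.component_closed)
  qed
  then show ?thesis using x by blast
qed

lemma homogeneous_smult_ext:
  assumes "r \<in> carrier R" "x \<in> carrier M" "T \<subseteq> carrier M" "\<zero>\<^bsub>M\<^esub> \<in> T"
    and "\<And>y z. y \<in> T \<Longrightarrow> z \<in> T \<Longrightarrow> y \<oplus>\<^bsub>M\<^esub> z \<in> T" "\<And>g a. a \<in> Rc g \<Longrightarrow> a \<odot>\<^bsub>M\<^esub> x \<in> T"
  shows "r \<odot>\<^bsub>M\<^esub> x \<in> T"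
proof -
  have "carrier R \<subseteq> {r\<in>carrier R. r \<odot>\<^bsub>M\<^esub> x \<in> T}"
    by (rule RD.carrier_subset_of_homogeneous)
      (use assms in \<open>auto simp: smult_l_distr RD.Ac_closed\<close>)
  then show ?thesis using assms(1) by blast
qed

text \<open>Recovers an actual submodule from its degree parts. It connects families with the
  hypotheses on \<open>R\<close> and \<open>M\<close>, which speak of ordinary ideals and
  submodules.\<close>

definition total :: "('g \<Rightarrow> 'b set) \<Rightarrow> 'b set"
  where "total N = {x\<in>carrier M. \<forall>t. component M Mc x t \<in> N t}"

lemma submodule_total:
  assumes N: "homogeneous_submodule Rc M Mc N"
  shows "submodule (total N) R M"
proof (rule submoduleI)
  have zero: "\<zero>\<^bsub>M\<^esub> \<in> N t" and add: "x \<in> N t \<Longrightarrow> y \<in> N t \<Longrightarrow> x \<oplus>\<^bsub>M\<^esub> y \<in> N t"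
    and smult: "r \<in> Rc g \<Longrightarrow> x \<in> N t \<Longrightarrow> r \<odot>\<^bsub>M\<^esub> x \<in> N (g + t)" for r g t x y
    using N by (auto simp: homogeneous_submodule_def)
  show sub: "total N \<subseteq> carrier M" by (auto simp: total_def)
  show 0: "\<zero>\<^bsub>M\<^esub> \<in> total N"
    using MD.component_homogeneous[OF MD.zero_in_Ac] zero by (simp add: total_def)
  show plus: "x \<oplus>\<^bsub>M\<^esub> y \<in> total N" if "x \<in> total N" "y \<in> total N" for x y
    using that by (auto simp: total_def MD.component_add intro: add)
  have hom: "r \<odot>\<^bsub>M\<^esub> x \<in> total N" if "r \<in> Rc g" "x \<in> total N" for r g x
  proof -
    have "r \<odot>\<^bsub>M\<^esub> component M Mc x (t - g) \<in> N t" for t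
      using smult[OF that(1), of _ "t - g"] that(2) by (simp add: total_def)
    then show ?thesis
      using that RD.Ac_closed by (auto simp: total_def component_smult)
  qed
  show mul: "r \<odot>\<^bsub>M\<^esub> x \<in> total N" if "r \<in> carrier R" "x \<in> total N" for r x
    by (rule homogeneous_smult_ext) (use that sub 0 plus hom in auto)
  show "\<ominus>\<^bsub>M\<^esub> x \<in> total N" if "x \<in> total N" for x
    using mul[of "\<ominus> \<one>" x] that sub by (auto simp: smult_l_minus)
qed

lemma total_degree:
  assumes N: "homogeneous_submodule Rc M Mc N"
  shows "total N \<inter> Mc t = N t"
proof -
  have "N t \<subseteq> Mc t" "\<zero>\<^bsub>M\<^esub> \<in> N s" for s using N by (auto simp: homogeneous_submodule_def)
  then show ?thesis
    using MD.Ac_closed by (auto simp: total_def MD.component_homogeneous) (metis MD.component_homogeneous)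
qed

text \<open>Let e be the degree 0 component of the unit. Comparing the degree g components in a = a
  1 for a of degree g gives a e = a. By additivity e is an identity on all of \<open>R\<close>,
  hence the unit itself.\<close>

lemma one_degree: "\<one> \<in> Rc 0"
proof -
  interpret S: full_graded_module R Rc "self_module R" Rc by (rule full_graded_self_module)
  let ?e = "component (self_module R) Rc \<one> 0"
  have e: "?e \<in> Rc 0" "?e \<in> carrier R" using S.MD.component_mem[of \<one>] S.MD.component_closed[of \<one>] by auto
  have "carrier R \<subseteq> {a\<in>carrier R. a \<otimes> ?e = a}"
  proof (rule RD.carrier_subset_of_homogeneous)
    fix g a assume a: "a \<in> Rc g"
    then have ac: "a \<in> carrier R" by (rule RD.Ac_closed)
    then have "component (self_module R) Rc (a \<otimes> \<one>) g = a \<otimes> ?e"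
      using S.component_smult[OF a, of \<one> g] by simp
    then show "a \<in> {a\<in>carrier R. a \<otimes> ?e = a}"
      using S.MD.component_homogeneous[OF a] ac by simp
  qed (use e in \<open>auto simp: l_distr\<close>)
  then have "\<one> \<otimes> ?e = \<one>" by blast
  then show ?thesis using e by simp
qed

text \<open>The nonzero components of finitely many generators are again finitely many. A
  homogeneous submodule containing them has a \<open>total\<close> that contains the generators.
  Pairs are used so that each generator carries its degree.\<close>

lemma homogeneous_generators:
  assumes "finitely_generated_module R M"
  obtains E where "finite E" "\<And>t x. (t, x) \<in> E \<Longrightarrow> x \<in> Mc t"
    "\<And>N. homogeneous_submodule Rc M Mc N \<Longrightarrow> (\<And>t x. (t, x) \<in> E \<Longrightarrow> x \<in> N t) \<Longrightarrow> N = Mc"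
proof -
  obtain S where S: "S \<subseteq> carrier M" "finite S" "carrier M = \<Inter>{N. submodule N R M \<and> S \<subseteq> N}"
    using assms unfolding finitely_generated_module_def by blast
  let ?E = "\<Union>s\<in>S. (\<lambda>t. (t, component M Mc s t)) ` {t. component M Mc s t \<noteq> \<zero>\<^bsub>M\<^esub>}"
  show thesis
  proof (rule that)
    show "finite ?E" using S MD.finite_components by auto
    show "x \<in> Mc t" if "(t, x) \<in> ?E" for t x
      using that S(1) MD.component_mem by auto
    fix N assume N: "homogeneous_submodule Rc M Mc N" and E: "\<And>t x. (t, x) \<in> ?E \<Longrightarrow> x \<in> N t"
    have "component M Mc s t \<in> N t" if "s \<in> S" for s t
      using E[of t "component M Mc s t"] that N by (cases "component M Mc s t = \<zero>\<^bsub>M\<^esub>") (auto simp: homogeneous_submodule_def)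
    then have "S \<subseteq> total N" using S(1) by (auto simp: total_def)
    then have "carrier M \<subseteq> total N" using S(3) submodule_total[OF N] by blast
    then have "Mc t \<subseteq> N t" for t using total_degree[OF N, of t] MD.Ac_closed by blast
    moreover have "N t \<subseteq> Mc t" for t using N by (auto simp: homogeneous_submodule_def)
    ultimately show "N = Mc" by blast
  qed
qed

text \<open>Passing to \<open>total\<close> is strictly monotone, since the degree parts can be read
  off again, and it lands in the ideals of \<open>R\<close>.\<close>

lemma acc_homogeneous_ideals:
  assumes "noetherian_ring R"
  shows "acc {J. homogeneous_submodule Rc (self_module R) Rc J}"
proof -
  interpret S: full_graded_module R Rc "self_module R" Rc by (rule full_graded_self_module)
  let ?H = "homogeneous_submodule Rc (self_module R) Rc"
  have ideal: "ideal (S.total J) R" if "?H J" for J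
  proof -
    interpret submodule "S.total J" R "self_module R" by (rule S.submodule_total[OF that])
    have "additive_subgroup (S.total J) R"
      using subgroup_axioms by (simp add: additive_subgroup_def subgroup_def m_inv_def)
    moreover have "x \<otimes> a \<in> S.total J" if "a \<in> S.total J" "x \<in> carrier R" for a x
      using smult_closed[OF that(2,1)] by simp
    moreover have "a \<in> carrier R" if "a \<in> S.total J" for a
      using that by (simp add: S.total_def)
    ultimately show ?thesis
      by (intro ideal.intro ideal_axioms.intro) (auto simp: ring_axioms m_comm)
  qed
  have mono: "S.total J < S.total J'" if "?H J" "?H J'" "J < J'" for J J'
  proof
    show "S.total J \<subseteq> S.total J'" using that(3) by (auto simp: S.total_def less_le le_fun_def)
    show "S.total J \<noteq> S.total J'"
      using that S.total_degree by (metis ext order_less_irrefl)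
  qed
  show ?thesis
    by (rule acc_strict_mono_image[OF acc_ideals[OF assms], of _ S.total]) (use ideal mono in auto)
qed

end

section \<open>Colon ideals, adjoined generators, and the chain condition for homogeneous
  submodules\<close>

context full_graded_module
begin

abbreviation hom_submod :: "('g \<Rightarrow> 'b set) \<Rightarrow> bool"
  where "hom_submod \<equiv> homogeneous_submodule Rc M Mc"

abbreviation hom_ideal :: "('g \<Rightarrow> 'a set) \<Rightarrow> bool"
  where "hom_ideal \<equiv> homogeneous_submodule Rc (self_module R) Rc"

abbreviation len :: "'b set \<Rightarrow> 'b set \<Rightarrow> enat"
  where "len B C \<equiv> height (degree_submodules Rc M B C)"

lemma hom_submodD:
  assumes "hom_submod N"
  shows "x \<in> N t \<Longrightarrow> x \<in> Mc t" "x \<in> N t \<Longrightarrow> x \<in> carrier M" "\<zero>\<^bsub>M\<^esub> \<in> N t"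
    "x \<in> N t \<Longrightarrow> y \<in> N t \<Longrightarrow> x \<oplus>\<^bsub>M\<^esub> y \<in> N t" "r \<in> Rc g \<Longrightarrow> x \<in> N t \<Longrightarrow> r \<odot>\<^bsub>M\<^esub> x \<in> N (g + t)"
proof -
  show *: "x \<in> N t \<Longrightarrow> x \<in> Mc t" "\<zero>\<^bsub>M\<^esub> \<in> N t" "x \<in> N t \<Longrightarrow> y \<in> N t \<Longrightarrow> x \<oplus>\<^bsub>M\<^esub> y \<in> N t"
    "r \<in> Rc g \<Longrightarrow> x \<in> N t \<Longrightarrow> r \<odot>\<^bsub>M\<^esub> x \<in> N (g + t)"
    using assms by (auto simp: homogeneous_submodule_def)
  show "x \<in> N t \<Longrightarrow> x \<in> carrier M" using *(1) MD.Ac_closed by blast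
qed

lemma minus_one_degree: "\<ominus> \<one> \<in> Rc 0"
  using subgroup.m_inv_closed[OF additive_subgroup.a_subgroup[OF RD.Ac_subgroup] one_degree]
  by (simp add: a_inv_def)

lemma a_inv_closed_of_smult:
  assumes "\<And>r x. r \<in> Rc 0 \<Longrightarrow> x \<in> K \<Longrightarrow> r \<odot>\<^bsub>M\<^esub> x \<in> K" "x \<in> K" "x \<in> carrier M"
  shows "\<ominus>\<^bsub>M\<^esub> x \<in> K"
  using assms(1)[OF minus_one_degree assms(2)] assms(3) by (simp add: smult_l_minus)

lemma hom_submod_a_inv:
  assumes "hom_submod N" "x \<in> N t"
  shows "\<ominus>\<^bsub>M\<^esub> x \<in> N t"
proof (rule a_inv_closed_of_smult)
  show "r \<odot>\<^bsub>M\<^esub> y \<in> N t" if "r \<in> Rc 0" "y \<in> N t" for r y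
    using hom_submodD(5)[OF assms(1) that] by simp
  show "x \<in> N t" "x \<in> carrier M" using assms hom_submodD(2) by blast+
qed

lemma hom_submod_minus:
  assumes "hom_submod N" "x \<in> N t" "y \<in> N t"
  shows "x \<ominus>\<^bsub>M\<^esub> y \<in> N t"
  using hom_submodD(4)[OF assms(1,2) hom_submod_a_inv[OF assms(1,3)]] by (simp add: a_minus_def)

lemma hom_submod_cancel:
  assumes "hom_submod N" "x \<in> N t" "x \<oplus>\<^bsub>M\<^esub> y \<in> N t" "y \<in> carrier M"
  shows "y \<in> N t"
proof -
  have x: "x \<in> carrier M" using assms(1,2) hom_submodD by blast
  have "\<ominus>\<^bsub>M\<^esub> x \<oplus>\<^bsub>M\<^esub> (x \<oplus>\<^bsub>M\<^esub> y) = y" using x assms(4) by (rule M.r_neg1)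
  then show ?thesis
    using hom_submodD(4)[OF assms(1) hom_submod_a_inv[OF assms(1,2)] assms(3)] by simp
qed

lemma hom_submod_Mc: "hom_submod Mc"
  using MD.zero_in_Ac MD.add_in_Ac smult_mem by (auto simp: homogeneous_submodule_def)

lemma hom_submod_zero: "hom_submod (\<lambda>t. {\<zero>\<^bsub>M\<^esub>})"
  using MD.zero_in_Ac RD.Ac_closed by (auto simp: homogeneous_submodule_def)

text \<open>The homogeneous ideal (N : x) for an element x of degree d, whence the shift of the
  degree by d.\<close>

definition colon :: "('g \<Rightarrow> 'b set) \<Rightarrow> 'g \<Rightarrow> 'b \<Rightarrow> 'g \<Rightarrow> 'a set"
  where "colon N d x g = {r\<in>Rc g. r \<odot>\<^bsub>M\<^esub> x \<in> N (g + d)}"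

lemma hom_ideal_colon:
  assumes N: "hom_submod N" and x: "x \<in> carrier M"
  shows "hom_ideal (colon N d x)"
proof -
  have "a \<otimes> r \<odot>\<^bsub>M\<^esub> x \<in> N (g + t + d)" if "a \<in> Rc g" "r \<in> Rc t" "r \<odot>\<^bsub>M\<^esub> x \<in> N (t + d)" for a r g t
    using hom_submodD(5)[OF N that(1,3)] that x by (simp add: smult_assoc1 RD.Ac_closed add.assoc)
  then show ?thesis
    using hom_submodD[OF N] x RD.zero_in_Ac RD.add_in_Ac ring_mult_degree
    by (auto simp: homogeneous_submodule_def colon_def smult_l_distr RD.Ac_closed)
qed

lemma colon_mono: "(\<And>t. N t \<subseteq> N' t) \<Longrightarrow> colon N d x g \<subseteq> colon N' d x g"
  by (auto simp: colon_def)

text \<open>The submodule N + Rx for x of degree d: only scalars of degree t - d take x into degree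
  t.\<close>

definition adjoin :: "('g \<Rightarrow> 'b set) \<Rightarrow> 'g \<Rightarrow> 'b \<Rightarrow> 'g \<Rightarrow> 'b set"
  where "adjoin N d x t = {l \<oplus>\<^bsub>M\<^esub> r \<odot>\<^bsub>M\<^esub> x | l r. l \<in> N t \<and> r \<in> Rc (t - d)}"

definition sum_set :: "'b set \<Rightarrow> 'b set \<Rightarrow> 'b set"
  where "sum_set A B = {a \<oplus>\<^bsub>M\<^esub> b | a b. a \<in> A \<and> b \<in> B}"

lemma hom_submod_adjoin:
  assumes N: "hom_submod N" and x: "x \<in> Mc d"
  shows "hom_submod (adjoin N d x)"
  unfolding homogeneous_submodule_def
proof (intro conjI allI ballI)
  note D = hom_submodD[OF N]
  have xc: "x \<in> carrier M" using x MD.Ac_closed by blast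
  fix t
  show "adjoin N d x t \<subseteq> Mc t"
    using D smult_mem[OF _ x, of _ "t - d"] by (auto simp: adjoin_def intro!: MD.add_in_Ac)
  have "\<zero>\<^bsub>M\<^esub> = \<zero>\<^bsub>M\<^esub> \<oplus>\<^bsub>M\<^esub> \<zero> \<odot>\<^bsub>M\<^esub> x" using xc by simp
  then show "\<zero>\<^bsub>M\<^esub> \<in> adjoin N d x t"
    unfolding adjoin_def using D(3) RD.zero_in_Ac by blast
  fix y z assume "y \<in> adjoin N d x t" "z \<in> adjoin N d x t"
  then obtain l r l' r' where *: "l \<in> N t" "r \<in> Rc (t - d)" "y = l \<oplus>\<^bsub>M\<^esub> r \<odot>\<^bsub>M\<^esub> x"
    "l' \<in> N t" "r' \<in> Rc (t - d)" "z = l' \<oplus>\<^bsub>M\<^esub> r' \<odot>\<^bsub>M\<^esub> x" by (auto simp: adjoin_def)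
  have "y \<oplus>\<^bsub>M\<^esub> z = (l \<oplus>\<^bsub>M\<^esub> l') \<oplus>\<^bsub>M\<^esub> (r \<oplus> r') \<odot>\<^bsub>M\<^esub> x"
    using * D(2) RD.Ac_closed xc by (simp add: smult_l_distr M.a_ac)
  then show "y \<oplus>\<^bsub>M\<^esub> z \<in> adjoin N d x t"
    unfolding adjoin_def using * D(4) RD.add_in_Ac by blast
next
  note D = hom_submodD[OF N]
  have xc: "x \<in> carrier M" using x MD.Ac_closed by blast
  fix g t a y assume a: "a \<in> Rc g" and "y \<in> adjoin N d x t"
  then obtain l r where *: "l \<in> N t" "r \<in> Rc (t - d)" "y = l \<oplus>\<^bsub>M\<^esub> r \<odot>\<^bsub>M\<^esub> x" by (auto simp: adjoin_def)
  have "a \<odot>\<^bsub>M\<^esub> y = a \<odot>\<^bsub>M\<^esub> l \<oplus>\<^bsub>M\<^esub> (a \<otimes> r) \<odot>\<^bsub>M\<^esub> x"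
    using * a D(2) RD.Ac_closed xc by (simp add: smult_r_distr smult_assoc1)
  moreover have "a \<otimes> r \<in> Rc (g + t - d)"
    using ring_mult_degree[of g "t - d" a r] a * by (simp add: add_diff_eq)
  ultimately show "a \<odot>\<^bsub>M\<^esub> y \<in> adjoin N d x (g + t)"
    unfolding adjoin_def using D(5)[OF a *(1)] by blast
qed

lemma subset_adjoin:
  assumes "hom_submod N" "x \<in> carrier M"
  shows "N t \<subseteq> adjoin N d x t"
proof
  fix l assume "l \<in> N t"
  then have "l \<in> N t" "\<zero> \<in> Rc (t - d)" "l = l \<oplus>\<^bsub>M\<^esub> \<zero> \<odot>\<^bsub>M\<^esub> x"
    using assms hom_submodD(2)[OF assms(1)] RD.zero_in_Ac by auto
  then show "l \<in> adjoin N d x t" unfolding adjoin_def by blast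
qed

lemma mem_adjoin:
  assumes "hom_submod N" "x \<in> carrier M"
  shows "x \<in> adjoin N d x d"
proof -
  have "\<zero>\<^bsub>M\<^esub> \<in> N d" "\<one> \<in> Rc (d - d)" "x = \<zero>\<^bsub>M\<^esub> \<oplus>\<^bsub>M\<^esub> \<one> \<odot>\<^bsub>M\<^esub> x"
    using assms hom_submodD(3)[OF assms(1)] one_degree by auto
  then show ?thesis unfolding adjoin_def by blast
qed

lemma adjoin_subset:
  assumes "hom_submod N'" "\<And>t. N t \<subseteq> N' t" "x \<in> N' d"
  shows "adjoin N d x t \<subseteq> N' t"
  using hom_submodD(5)[OF assms(1) _ assms(3), of _ "t - d"] assms(2)
  by (auto simp: adjoin_def intro!: hom_submodD(4)[OF assms(1)])

lemma hom_submod_sum: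
  assumes N: "hom_submod N" and K: "hom_submod K"
  shows "hom_submod (\<lambda>t. sum_set (N t) (K t))"
  unfolding homogeneous_submodule_def
proof (intro conjI allI ballI)
  note D = hom_submodD[OF N] and E = hom_submodD[OF K]
  fix t
  show "sum_set (N t) (K t) \<subseteq> Mc t" using D E by (auto simp: sum_set_def intro!: MD.add_in_Ac)
  have "\<zero>\<^bsub>M\<^esub> = \<zero>\<^bsub>M\<^esub> \<oplus>\<^bsub>M\<^esub> \<zero>\<^bsub>M\<^esub>" by simp
  then show "\<zero>\<^bsub>M\<^esub> \<in> sum_set (N t) (K t)" unfolding sum_set_def using D(3) E(3) by blast
  fix y z assume "y \<in> sum_set (N t) (K t)" "z \<in> sum_set (N t) (K t)"
  then obtain l k l' k' where *: "l \<in> N t" "k \<in> K t" "y = l \<oplus>\<^bsub>M\<^esub> k"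
    "l' \<in> N t" "k' \<in> K t" "z = l' \<oplus>\<^bsub>M\<^esub> k'" by (auto simp: sum_set_def)
  have "y \<oplus>\<^bsub>M\<^esub> z = (l \<oplus>\<^bsub>M\<^esub> l') \<oplus>\<^bsub>M\<^esub> (k \<oplus>\<^bsub>M\<^esub> k')"
    using * D(2) E(2) by (simp add: M.a_ac)
  then show "y \<oplus>\<^bsub>M\<^esub> z \<in> sum_set (N t) (K t)"
    unfolding sum_set_def using * D(4) E(4) by blast
next
  note D = hom_submodD[OF N] and E = hom_submodD[OF K]
  fix g t a y assume a: "a \<in> Rc g" and "y \<in> sum_set (N t) (K t)"
  then obtain l k where *: "l \<in> N t" "k \<in> K t" "y = l \<oplus>\<^bsub>M\<^esub> k" by (auto simp: sum_set_def)
  have "a \<odot>\<^bsub>M\<^esub> y = a \<odot>\<^bsub>M\<^esub> l \<oplus>\<^bsub>M\<^esub> a \<odot>\<^bsub>M\<^esub> k"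
    using * a D(2) E(2) RD.Ac_closed by (simp add: smult_r_distr)
  then show "a \<odot>\<^bsub>M\<^esub> y \<in> sum_set (N (g + t)) (K (g + t))"
    unfolding sum_set_def using D(5)[OF a *(1)] E(5)[OF a *(2)] by blast
qed

lemma sum_set_mono: "B \<subseteq> B' \<Longrightarrow> sum_set A B \<subseteq> sum_set A B'"
  by (auto simp: sum_set_def)

text \<open>Among comparable submodules, \<open>K\<close> is determined by its intersection with
  \<open>N\<close> and by its image in the cyclic quotient (N + Rx)/N. The image is recorded by the
  ideal of all r with rx in N + K, so the chain condition of the ring applies to it.\<close>

lemma acc_adjoin:
  assumes N: "hom_submod N" and x: "x \<in> Mc d"
    and accN: "acc {K. hom_submod K \<and> K \<le> N}" and accR: "acc {J. hom_ideal J}"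
  shows "acc {K. hom_submod K \<and> K \<le> adjoin N d x}"
proof (rule acc_lex_image[OF accN accR])
  let ?f = "\<lambda>K t. K t \<inter> N t" and ?g = "\<lambda>K. colon (\<lambda>t. sum_set (N t) (K t)) d x"
  have xc: "x \<in> carrier M" using x MD.Ac_closed by blast
  fix K assume "K \<in> {K. hom_submod K \<and> K \<le> adjoin N d x}"
  then have K: "hom_submod K" "K \<le> adjoin N d x" by auto
  show "?f K \<in> {K. hom_submod K \<and> K \<le> N}"
    using K(1) N by (auto simp: homogeneous_submodule_def le_fun_def)
  show "?g K \<in> {J. hom_ideal J}"
    using hom_ideal_colon[OF hom_submod_sum[OF N K(1)] xc] by simp
  fix K' assume "K' \<in> {K. hom_submod K \<and> K \<le> adjoin N d x}" and less: "K < K'"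
  then have K': "hom_submod K'" "K' \<le> adjoin N d x" by auto
  have sub: "K t \<subseteq> K' t" for t using less by (auto simp: less_le le_fun_def)
  have f: "?f K \<le> ?f K'" using sub by (auto simp: le_fun_def)
  have g: "?g K \<le> ?g K'" using sub by (intro le_funI colon_mono sum_set_mono)
  have "K' \<le> K" if eq: "?f K = ?f K'" "?g K = ?g K'"
  proof (intro le_funI subsetI)
    fix t y assume y: "y \<in> K' t"
    then obtain l r where lr: "l \<in> N t" "r \<in> Rc (t - d)" "y = l \<oplus>\<^bsub>M\<^esub> r \<odot>\<^bsub>M\<^esub> x"
      using subsetD[OF le_funD[OF K'(2)] y] by (auto simp: adjoin_def)
    have c: "l \<in> carrier M" "r \<in> carrier R" "y \<in> carrier M"
      using lr y hom_submodD(2) N K'(1) RD.Ac_closed by blast+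
    have "r \<odot>\<^bsub>M\<^esub> x = \<ominus>\<^bsub>M\<^esub> l \<oplus>\<^bsub>M\<^esub> y" using c xc lr(3) by (simp add: M.r_neg1)
    then have "r \<odot>\<^bsub>M\<^esub> x \<in> sum_set (N t) (K' t)"
      unfolding sum_set_def using hom_submod_a_inv[OF N lr(1)] y by blast
    then have "r \<in> ?g K' (t - d)" using lr(2) by (simp add: colon_def)
    then have "r \<odot>\<^bsub>M\<^esub> x \<in> sum_set (N t) (K t)" unfolding eq(2)[symmetric] by (simp add: colon_def)
    then obtain l' k where lk: "l' \<in> N t" "k \<in> K t" "r \<odot>\<^bsub>M\<^esub> x = l' \<oplus>\<^bsub>M\<^esub> k" by (auto simp: sum_set_def)
    have c': "l' \<in> carrier M" "k \<in> carrier M" using lk hom_submodD(2) N K(1) by blast+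
    \<comment> \<open>Modulo \<open>k\<close>, which lies in both \<open>K\<close> and
      \<open>K'\<close>, the element \<open>y\<close> is l + l' in \<open>N\<close>. So l + l' lies
      in the intersection of \<open>K'\<close> with \<open>N\<close>, which equals that of
      \<open>K\<close> with \<open>N\<close>.\<close>
    have "y = k \<oplus>\<^bsub>M\<^esub> (l \<oplus>\<^bsub>M\<^esub> l')" using lr(3) lk(3) c c' by (simp add: M.a_ac)
    then have "l \<oplus>\<^bsub>M\<^esub> l' \<in> K' t"
      using hom_submod_cancel[OF K'(1), of k t] sub lk(2) y c c' by auto
    then have "l \<oplus>\<^bsub>M\<^esub> l' \<in> K t"
      using fun_cong[OF eq(1), of t] hom_submodD(4)[OF N lr(1) lk(1)] by blast
    then show "y \<in> K t"
      using \<open>y = k \<oplus>\<^bsub>M\<^esub> (l \<oplus>\<^bsub>M\<^esub> l')\<close> hom_submodD(4)[OF K(1) lk(2)] by simp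
  qed
  then have "\<not> (?f K = ?f K' \<and> ?g K = ?g K')" using less leD by blast
  then show "?f K < ?f K' \<or> ?f K = ?f K' \<and> ?g K < ?g K'"
    unfolding order.strict_iff_order using f g by blast
qed

text \<open>Generators are adjoined to the zero submodule one at a time, carrying the chain
  condition for the submodules of what has been reached. Once all of \<open>E\<close> is contained,
  the result must be \<open>Mc\<close>.\<close>

lemma acc_hom_submod:
  assumes "noetherian_ring R" "finitely_generated_module R M"
  shows "acc {N. hom_submod N}"
proof -
  obtain E where E: "finite E" "\<And>t x. (t, x) \<in> E \<Longrightarrow> x \<in> Mc t"
    "\<And>N. hom_submod N \<Longrightarrow> (\<And>t x. (t, x) \<in> E \<Longrightarrow> x \<in> N t) \<Longrightarrow> N = Mc"
    using homogeneous_generators[OF assms(2)] by metis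
  have accR: "acc {J. hom_ideal J}" by (rule acc_homogeneous_ideals[OF assms(1)])
  have "\<exists>N. hom_submod N \<and> (\<forall>(t, x)\<in>F. x \<in> N t) \<and> acc {K. hom_submod K \<and> K \<le> N}"
    if "finite F" "F \<subseteq> E" for F
    using that
  proof (induction F)
    case empty
    have "{K. hom_submod K \<and> K \<le> (\<lambda>t. {\<zero>\<^bsub>M\<^esub>})} \<subseteq> {\<lambda>t. {\<zero>\<^bsub>M\<^esub>}}"
    proof
      fix K assume "K \<in> {K. hom_submod K \<and> K \<le> (\<lambda>t. {\<zero>\<^bsub>M\<^esub>})}"
      then have "K t = {\<zero>\<^bsub>M\<^esub>}" for t
        using hom_submodD(3)[of K t] by (auto simp: le_fun_def)
      then show "K \<in> {\<lambda>t. {\<zero>\<^bsub>M\<^esub>}}" by auto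
    qed
    then have "acc {K. hom_submod K \<and> K \<le> (\<lambda>t. {\<zero>\<^bsub>M\<^esub>})}" by (rule acc_singleton)
    then show ?case using hom_submod_zero by blast
  next
    case (insert p F)
    then obtain N where N: "hom_submod N" "\<forall>(t, x)\<in>F. x \<in> N t" "acc {K. hom_submod K \<and> K \<le> N}" by auto
    obtain d x where p: "p = (d, x)" by fastforce
    have x: "x \<in> Mc d" using insert.prems E(2) p by blast
    then have xc: "x \<in> carrier M" by (rule MD.Ac_closed)
    show ?case
    proof (intro exI conjI)
      show "hom_submod (adjoin N d x)" by (rule hom_submod_adjoin[OF N(1) x])
      show "\<forall>(t, y)\<in>insert p F. y \<in> adjoin N d x t"
        using N(2) p mem_adjoin[OF N(1) xc] subset_adjoin[OF N(1) xc] by blast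
      show "acc {K. hom_submod K \<and> K \<le> adjoin N d x}" by (rule acc_adjoin[OF N(1) x N(3) accR])
    qed
  qed
  from this[OF E(1) subset_refl] obtain N where N: "hom_submod N" "\<forall>(t, x)\<in>E. x \<in> N t"
    "acc {K. hom_submod K \<and> K \<le> N}" by blast
  have "N = Mc" using E(3)[OF N(1)] N(2) by blast
  moreover have "K \<le> Mc" if "hom_submod K" for K using that hom_submodD(1) by (auto simp: le_fun_def)
  then have "{K. hom_submod K \<and> K \<le> Mc} = {K. hom_submod K}" by blast
  ultimately show ?thesis using N(3) by simp
qed

section \<open>R_0-submodules of a single component and additivity of length\<close>

lemma degree_submodulesD:
  assumes "K \<in> degree_submodules Rc M B C"
  shows "B \<subseteq> K" "K \<subseteq> C" "\<zero>\<^bsub>M\<^esub> \<in> K" "x \<in> K \<Longrightarrow> y \<in> K \<Longrightarrow> x \<oplus>\<^bsub>M\<^esub> y \<in> K" "r \<in> Rc 0 \<Longrightarrow> x \<in> K \<Longrightarrow> r \<odot>\<^bsub>M\<^esub> x \<in> K"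
  using assms by (auto simp: degree_submodules_def)

lemma degree_submodules_a_inv:
  assumes "K \<in> degree_submodules Rc M B C" "x \<in> K" "C \<subseteq> carrier M"
  shows "\<ominus>\<^bsub>M\<^esub> x \<in> K"
proof (rule a_inv_closed_of_smult)
  show "r \<odot>\<^bsub>M\<^esub> y \<in> K" if "r \<in> Rc 0" "y \<in> K" for r y
    by (rule degree_submodulesD(5)[OF assms(1) that])
  show "x \<in> K" "x \<in> carrier M" using assms(2,3) degree_submodulesD(2)[OF assms(1)] by blast+
qed

lemma degree_submodules_cancel:
  assumes "K \<in> degree_submodules Rc M B C" "C \<subseteq> carrier M" "x \<in> K" "x \<oplus>\<^bsub>M\<^esub> y \<in> K" "y \<in> carrier M"
  shows "y \<in> K"
proof -
  have x: "x \<in> carrier M" using assms(1-3) degree_submodulesD(2) by blast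
  have "\<ominus>\<^bsub>M\<^esub> x \<oplus>\<^bsub>M\<^esub> (x \<oplus>\<^bsub>M\<^esub> y) = y" using x assms(5) by (rule M.r_neg1)
  then show ?thesis
    using degree_submodulesD(4)[OF assms(1) degree_submodules_a_inv[OF assms(1,3,2)] assms(4)] by simp
qed

lemma hom_submod_degree:
  assumes "hom_submod N" "B \<subseteq> N t" "N t \<subseteq> C"
  shows "N t \<in> degree_submodules Rc M B C"
  using assms(2,3) hom_submodD[OF assms(1)] hom_submodD(5)[OF assms(1), of _ 0 _ t]
  by (auto simp: degree_submodules_def)

lemma sum_set_degree_submodules:
  assumes H: "H \<in> degree_submodules Rc M B1 C1" and K: "K \<in> degree_submodules Rc M B2 C2"
    and sub: "C1 \<subseteq> carrier M" "C2 \<subseteq> carrier M" and B: "B \<subseteq> sum_set H K" "sum_set H K \<subseteq> C"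
  shows "sum_set H K \<in> degree_submodules Rc M B C"
proof -
  note D = degree_submodulesD[OF H] and E = degree_submodulesD[OF K]
  have c: "x \<in> H \<Longrightarrow> x \<in> carrier M" "x \<in> K \<Longrightarrow> x \<in> carrier M" for x using D(2) E(2) sub by blast+
  have zero: "\<zero>\<^bsub>M\<^esub> \<in> sum_set H K"
  proof -
    have "\<zero>\<^bsub>M\<^esub> = \<zero>\<^bsub>M\<^esub> \<oplus>\<^bsub>M\<^esub> \<zero>\<^bsub>M\<^esub>" by simp
    then show ?thesis unfolding sum_set_def using D(3) E(3) by blast
  qed
  have add: "y \<oplus>\<^bsub>M\<^esub> z \<in> sum_set H K" if yz: "y \<in> sum_set H K" "z \<in> sum_set H K" for y z
  proof -
    obtain l k l' k' where *: "l \<in> H" "k \<in> K" "y = l \<oplus>\<^bsub>M\<^esub> k"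
      "l' \<in> H" "k' \<in> K" "z = l' \<oplus>\<^bsub>M\<^esub> k'" using yz by (auto simp: sum_set_def)
    have "y \<oplus>\<^bsub>M\<^esub> z = (l \<oplus>\<^bsub>M\<^esub> l') \<oplus>\<^bsub>M\<^esub> (k \<oplus>\<^bsub>M\<^esub> k')" using * c by (simp add: M.a_ac)
    then show ?thesis unfolding sum_set_def using * D(4) E(4) by blast
  qed
  have smult: "a \<odot>\<^bsub>M\<^esub> y \<in> sum_set H K" if a: "a \<in> Rc 0" and y: "y \<in> sum_set H K" for a y
  proof -
    obtain l k where *: "l \<in> H" "k \<in> K" "y = l \<oplus>\<^bsub>M\<^esub> k" using y by (auto simp: sum_set_def)
    have "a \<odot>\<^bsub>M\<^esub> y = a \<odot>\<^bsub>M\<^esub> l \<oplus>\<^bsub>M\<^esub> a \<odot>\<^bsub>M\<^esub> k"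
      using * a c RD.Ac_closed by (simp add: smult_r_distr)
    then show ?thesis unfolding sum_set_def using D(5)[OF a *(1)] E(5)[OF a *(2)] by blast
  qed
  show ?thesis unfolding degree_submodules_def using B zero add smult by blast
qed

lemma subset_sum_set:
  assumes "\<zero>\<^bsub>M\<^esub> \<in> H" "\<zero>\<^bsub>M\<^esub> \<in> K" "H \<subseteq> carrier M" "K \<subseteq> carrier M"
  shows "H \<subseteq> sum_set H K" "K \<subseteq> sum_set H K"
proof -
  have "x = x \<oplus>\<^bsub>M\<^esub> \<zero>\<^bsub>M\<^esub>" "x = \<zero>\<^bsub>M\<^esub> \<oplus>\<^bsub>M\<^esub> x" if "x \<in> carrier M" for x using that by simp_all
  then show "H \<subseteq> sum_set H K" "K \<subseteq> sum_set H K" unfolding sum_set_def using assms by blast+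
qed

text \<open>The projections for \<open>height_additive\<close> are intersection with
  \<open>B\<close> and sum with \<open>B\<close>. Comparable K and K' with equal projections agree:
  write y in K' as k + b; then b lies in K' and in B, hence in K.\<close>

lemma len_additive:
  assumes B: "B \<in> degree_submodules Rc M A C" and C: "C \<in> degree_submodules Rc M A C" "C \<subseteq> carrier M"
  shows "len A C = len A B + len B C"
proof -
  let ?S = "degree_submodules Rc M A C"
  have eq: "{x\<in>?S. x \<le> B} = degree_submodules Rc M A B" "{x\<in>?S. B \<le> x} = degree_submodules Rc M B C"
    using B by (auto simp: degree_submodules_def)
  have "height ?S = height {x\<in>?S. x \<le> B} + height {x\<in>?S. B \<le> x}"
  proof (rule height_additive[of B ?S "\<lambda>K. K \<inter> B" "\<lambda>K. sum_set K B"])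
    show "B \<in> ?S" by (rule B)
    fix K assume K: "K \<in> ?S"
    have c: "B \<subseteq> carrier M" "K \<subseteq> carrier M"
      using K B C(2) degree_submodulesD(2) by blast+
    show "K \<inter> B \<in> ?S \<and> K \<inter> B \<le> B" using K B by (auto simp: degree_submodules_def)
    have sub: "K \<subseteq> sum_set K B" "B \<subseteq> sum_set K B"
      using subset_sum_set[OF _ _ c(2,1)] K B degree_submodulesD(3) by blast+
    have "sum_set K B \<subseteq> C"
      using degree_submodulesD(2)[OF K] degree_submodulesD(2)[OF B] degree_submodulesD(4)[OF C(1)]
      by (auto simp: sum_set_def)
    moreover have "A \<subseteq> sum_set K B" using sub degree_submodulesD(1)[OF B] by blast
    ultimately show "sum_set K B \<in> ?S \<and> B \<le> sum_set K B"
      using sum_set_degree_submodules[OF K B C(2) C(2)] sub(2) by blast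
    fix K' assume K': "K' \<in> ?S" and le: "K \<le> K'"
    show "K \<inter> B \<le> K' \<inter> B" "sum_set K B \<le> sum_set K' B" using le by (auto simp: sum_set_def)
    assume e: "K \<inter> B = K' \<inter> B" "sum_set K B = sum_set K' B"
    have "K' \<subseteq> K"
    proof
      fix y assume y: "y \<in> K'"
      have c': "K' \<subseteq> carrier M" using K' C(2) degree_submodulesD(2) by blast
      have "y \<in> sum_set K' B" using subset_sum_set(1)[OF _ _ c' c(1)] K' B degree_submodulesD(3) y by blast
      then have "y \<in> sum_set K B" unfolding e(2) .
      then obtain k b where kb: "k \<in> K" "b \<in> B" "y = k \<oplus>\<^bsub>M\<^esub> b" by (auto simp: sum_set_def)
      then have "b \<in> K'" using degree_submodules_cancel[OF K' C(2), of k b] le y c by auto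
      then have "b \<in> K" using e(1) kb(2) by blast
      then show "y \<in> K" using kb degree_submodulesD(4)[OF K] by blast
    qed
    then show "K = K'" using le by blast
  qed
  then show ?thesis unfolding eq .
qed

lemma graded_length_eq_len: "graded_length R Rc M Mc t = len {\<zero>\<^bsub>M\<^esub>} (Mc t)"
proof -
  have sub: "submodule K (R\<lparr>carrier := Rc 0\<rparr>) (M\<lparr>carrier := Mc t\<rparr>) \<longleftrightarrow>
      K \<in> degree_submodules Rc M {\<zero>\<^bsub>M\<^esub>} (Mc t)" for K
  proof
    assume "submodule K (R\<lparr>carrier := Rc 0\<rparr>) (M\<lparr>carrier := Mc t\<rparr>)"
    then interpret submodule K "R\<lparr>carrier := Rc 0\<rparr>" "M\<lparr>carrier := Mc t\<rparr>" .
    show "K \<in> degree_submodules Rc M {\<zero>\<^bsub>M\<^esub>} (Mc t)"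
      using subset m_closed one_closed smult_closed by (auto simp: degree_submodules_def)
  next
    assume K: "K \<in> degree_submodules Rc M {\<zero>\<^bsub>M\<^esub>} (Mc t)"
    note D = degree_submodulesD[OF K]
    \<comment> \<open>The inverse in the restricted record is a definite description over the
      smaller carrier \<open>Mc t\<close>, so it must be identified with the negative in
      \<open>M\<close>.\<close>
    have inv: "inv\<^bsub>add_monoid (M\<lparr>carrier := Mc t\<rparr>)\<^esub> x \<in> K" if x: "x \<in> K" for x
    proof -
      have xc: "x \<in> carrier M" using x D(2) MD.Ac_closed by blast
      have neg: "\<ominus>\<^bsub>M\<^esub> x \<in> K" by (rule degree_submodules_a_inv[OF K x]) (use MD.Ac_closed in blast)
      have "inv\<^bsub>add_monoid (M\<lparr>carrier := Mc t\<rparr>)\<^esub> x = \<ominus>\<^bsub>M\<^esub> x"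
        unfolding m_inv_def
      proof (rule the_equality)
        show "\<ominus>\<^bsub>M\<^esub> x \<in> carrier (add_monoid (M\<lparr>carrier := Mc t\<rparr>)) \<and>
          x \<otimes>\<^bsub>add_monoid (M\<lparr>carrier := Mc t\<rparr>)\<^esub> \<ominus>\<^bsub>M\<^esub> x = \<one>\<^bsub>add_monoid (M\<lparr>carrier := Mc t\<rparr>)\<^esub> \<and>
          \<ominus>\<^bsub>M\<^esub> x \<otimes>\<^bsub>add_monoid (M\<lparr>carrier := Mc t\<rparr>)\<^esub> x = \<one>\<^bsub>add_monoid (M\<lparr>carrier := Mc t\<rparr>)\<^esub>"
          using neg D(2) xc by (auto simp: M.r_neg M.l_neg)
      next
        fix y assume "y \<in> carrier (add_monoid (M\<lparr>carrier := Mc t\<rparr>)) \<and>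
          x \<otimes>\<^bsub>add_monoid (M\<lparr>carrier := Mc t\<rparr>)\<^esub> y = \<one>\<^bsub>add_monoid (M\<lparr>carrier := Mc t\<rparr>)\<^esub> \<and>
          y \<otimes>\<^bsub>add_monoid (M\<lparr>carrier := Mc t\<rparr>)\<^esub> x = \<one>\<^bsub>add_monoid (M\<lparr>carrier := Mc t\<rparr>)\<^esub>"
        then show "y = \<ominus>\<^bsub>M\<^esub> x" using xc MD.Ac_closed by (auto intro: M.minus_equality[symmetric])
      qed
      then show ?thesis using neg by simp
    qed
    show "submodule K (R\<lparr>carrier := Rc 0\<rparr>) (M\<lparr>carrier := Mc t\<rparr>)"
      by (intro submodule.intro subgroup.intro submodule_axioms.intro) (use D inv in auto)
  qed
  have "Mc t \<in> degree_submodules Rc M {\<zero>\<^bsub>M\<^esub>} (Mc t)"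
    using hom_submod_degree[OF hom_submod_Mc] MD.zero_in_Ac by simp
  then show ?thesis
    by (subst height_eq_SUP_sequences) (auto simp: graded_length_def module_length_def sub)
qed

end

section \<open>Artinian rings and modules of finite length\<close>

lemma (in ring) minus_add_cancel: "x \<in> carrier R \<Longrightarrow> y \<in> carrier R \<Longrightarrow> (x \<ominus> y) \<oplus> y = x"
  by (simp add: a_minus_def a_assoc l_neg)

lemma (in cring) ideal_of_closed:
  assumes "H \<subseteq> carrier R" "\<zero> \<in> H" "\<And>a b. a \<in> H \<Longrightarrow> b \<in> H \<Longrightarrow> a \<oplus> b \<in> H"
    and "\<And>a x. a \<in> H \<Longrightarrow> x \<in> carrier R \<Longrightarrow> x \<otimes> a \<in> H"
  shows "ideal H R"
proof (rule idealI[OF ring_axioms])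
  have "\<ominus> a \<in> H" if "a \<in> H" for a
    using assms(4)[OF that, of "\<ominus> \<one>"] assms(1) that by (auto simp: l_minus)
  then show "subgroup H (add_monoid R)"
    using assms(1-3) by (intro add.subgroupI) (auto simp: a_inv_def)
  show "x \<otimes> a \<in> H" "a \<otimes> x \<in> H" if "a \<in> H" "x \<in> carrier R" for a x
    using assms(1) assms(4)[OF that] that m_comm[of a x] by auto
qed

context full_graded_module
begin

text \<open>An R_0-submodule \<open>K\<close> of the component in degree t is sent to the largest
  homogeneous submodule whose part in degree t lies in \<open>K\<close>. That part is
  \<open>K\<close> again because the unit has degree 0, so the map is strictly monotone.\<close>

lemma acc_degree_submodules:
  assumes "acc {N. hom_submod N}"
  shows "acc (degree_submodules Rc M {\<zero>\<^bsub>M\<^esub>} (Mc t))"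
proof (rule acc_strict_mono_image[OF assms])
  let ?F = "\<lambda>K s. {y\<in>Mc s. \<forall>r\<in>Rc (t - s). r \<odot>\<^bsub>M\<^esub> y \<in> K}"
  have Ft: "?F K t = K" if K: "K \<in> degree_submodules Rc M {\<zero>\<^bsub>M\<^esub>} (Mc t)" for K
  proof -
    have "y \<in> K" if "y \<in> Mc t" "\<forall>r\<in>Rc 0. r \<odot>\<^bsub>M\<^esub> y \<in> K" for y
      using that one_degree MD.Ac_closed[of y t] smult_one[of y] by metis
    then show ?thesis
      using degree_submodulesD(2,5)[OF K] by auto
  qed
  show "?F K \<in> {N. hom_submod N}" if K: "K \<in> degree_submodules Rc M {\<zero>\<^bsub>M\<^esub>} (Mc t)" for K
  proof -
    note D = degree_submodulesD[OF K]
    have "?F K s \<subseteq> Mc s" "\<zero>\<^bsub>M\<^esub> \<in> ?F K s" for s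
      using D(3) MD.zero_in_Ac RD.Ac_closed by auto
    moreover have "x \<oplus>\<^bsub>M\<^esub> y \<in> ?F K s" if "x \<in> ?F K s" "y \<in> ?F K s" for x y s
      using that MD.add_in_Ac D(4) RD.Ac_closed MD.Ac_closed by (auto simp: smult_r_distr)
    moreover have "a \<odot>\<^bsub>M\<^esub> x \<in> ?F K (g + s)" if a: "a \<in> Rc g" and x: "x \<in> ?F K s" for a x g s
    proof -
      have "r \<odot>\<^bsub>M\<^esub> (a \<odot>\<^bsub>M\<^esub> x) \<in> K" if r: "r \<in> Rc (t - (g + s))" for r
      proof -
        have "r \<otimes> a \<in> Rc (t - s)" using ring_mult_degree[OF _ _ r a] by (simp add: algebra_simps)
        then have "(r \<otimes> a) \<odot>\<^bsub>M\<^esub> x \<in> K" using x by blast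
        moreover have "r \<in> carrier R" "a \<in> carrier R" "x \<in> carrier M"
          using a r x RD.Ac_closed MD.Ac_closed by blast+
        ultimately show ?thesis by (simp add: smult_assoc1)
      qed
      then show ?thesis using x smult_mem[OF a] by blast
    qed
    ultimately show ?thesis unfolding homogeneous_submodule_def by blast
  qed
  fix K K' assume K: "K \<in> degree_submodules Rc M {\<zero>\<^bsub>M\<^esub>} (Mc t)" "K' \<in> degree_submodules Rc M {\<zero>\<^bsub>M\<^esub>} (Mc t)" "K < K'"
  show "?F K < ?F K'"
    unfolding less_le_not_le
  proof
    show "?F K \<le> ?F K'" using K(3) by (auto simp: le_fun_def)
    show "\<not> ?F K' \<le> ?F K"
      using le_funD[of "?F K'" "?F K" t] Ft[OF K(1)] Ft[OF K(2)] K(3) by auto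
  qed
qed

text \<open>Take a largest \<open>K\<close> at finite length above \<open>A\<close>. If it were not
  \<open>C\<close>, the descending chain condition would supply a minimal \<open>L\<close> above
  \<open>K\<close>; the interval from \<open>K\<close> to \<open>L\<close> has only two elements, so
  \<open>L\<close> too would be at finite length.\<close>

lemma len_finite_of_acc_dcc:
  assumes AC: "A \<in> degree_submodules Rc M A C" "C \<in> degree_submodules Rc M A C" "C \<subseteq> carrier M"
    and acc: "acc (degree_submodules Rc M A C)" and dcc: "dcc (degree_submodules Rc M A C)"
  shows "len A C < \<infinity>"
proof -
  let ?S = "degree_submodules Rc M A C"
  have "degree_submodules Rc M A A \<subseteq> {A}" by (auto simp: degree_submodules_def)
  then have "len A A = 0" by (rule height_singleton)
  then have "len A A < \<infinity>" by (auto simp: zero_enat_def)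
  then have "A \<in> {K\<in>?S. len A K < \<infinity>}" using AC(1) by blast
  then have "\<exists>K\<in>{K\<in>?S. len A K < \<infinity>}. \<forall>L\<in>{K\<in>?S. len A K < \<infinity>}. \<not> K < L"
    by (intro acc_maximal[OF acc]) blast+
  then obtain K where "K \<in> {K\<in>?S. len A K < \<infinity>}" "\<forall>L\<in>{K\<in>?S. len A K < \<infinity>}. \<not> K < L"
    by (rule bexE)
  then have K: "K \<in> ?S" "len A K < \<infinity>" "\<And>L. L \<in> ?S \<Longrightarrow> len A L < \<infinity> \<Longrightarrow> \<not> K < L"
    by simp_all
  show ?thesis
  proof (cases "K = C")
    case False
    then have "C \<in> {L\<in>?S. K < L}" using AC(2) degree_submodulesD(2)[OF K(1)] by blast
    then have "\<exists>L\<in>{L\<in>?S. K < L}. \<forall>H\<in>{L\<in>?S. K < L}. \<not> H < L"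
      by (intro dcc_minimal[OF dcc]) blast+
    then obtain L where "L \<in> {L\<in>?S. K < L}" "\<forall>H\<in>{L\<in>?S. K < L}. \<not> H < L" by (rule bexE)
    then have L: "L \<in> ?S" "K < L" "\<And>H. H \<in> ?S \<Longrightarrow> K < H \<Longrightarrow> \<not> H < L" by simp_all
    have "degree_submodules Rc M K L \<subseteq> {K, L}"
    proof
      fix H assume H: "H \<in> degree_submodules Rc M K L"
      then have "K \<subseteq> H" "H \<subseteq> L" "H \<in> ?S"
        using degree_submodulesD(1)[OF K(1)] degree_submodulesD(2)[OF L(1)]
        by (auto simp: degree_submodules_def)
      then show "H \<in> {K, L}" using L(3)[of H] by blast
    qed
    then have "len K L \<le> 1" by (rule height_subset_pair)
    then have "len K L < \<infinity>" by (rule order_le_less_trans) (simp add: one_enat_def)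
    moreover have "len A L = len A K + len K L"
    proof (rule len_additive)
      show "K \<in> degree_submodules Rc M A L" "L \<in> degree_submodules Rc M A L"
        using K(1) L(1,2) by (auto simp: degree_submodules_def)
      show "L \<subseteq> carrier M" using degree_submodulesD(2)[OF L(1)] AC(3) by blast
    qed
    ultimately have "len A L < \<infinity>"
      using K(2) by auto
    then show ?thesis using K(3) L by blast
  qed (use K in simp)
qed

section \<open>Comparing lengths in R_0 with lengths in the components of the module\<close>

abbreviation ring_len :: "'a set \<Rightarrow> 'a set \<Rightarrow> enat"
  where "ring_len A B \<equiv> height (degree_submodules Rc (self_module R) A B)"

lemma ring_degree_submodulesD:
  assumes "K \<in> degree_submodules Rc (self_module R) B C"
  shows "B \<subseteq> K" "K \<subseteq> C" "\<zero> \<in> K" "x \<in> K \<Longrightarrow> y \<in> K \<Longrightarrow> x \<oplus> y \<in> K" "r \<in> Rc 0 \<Longrightarrow> x \<in> K \<Longrightarrow> r \<otimes> x \<in> K"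
  using assms by (auto simp: degree_submodules_def)

lemma ring_degree_submodules_minus:
  assumes "K \<in> degree_submodules Rc (self_module R) B C" "C \<subseteq> carrier R" "x \<in> K" "y \<in> K"
  shows "x \<ominus> y \<in> K"
proof -
  note D = ring_degree_submodulesD[OF assms(1)]
  have "\<ominus> y = \<ominus> \<one> \<otimes> y" using assms(2,4) D(2) by (auto simp: l_minus)
  then have "\<ominus> y \<in> K" using D(5)[OF minus_one_degree assms(4)] by simp
  then show ?thesis using D(4)[OF assms(3)] by (simp add: a_minus_def)
qed

lemma smult_image_degree_submodules:
  assumes K: "K \<in> degree_submodules Rc (self_module R) B (Rc 0)" and x: "x \<in> Mc d"
  shows "(\<lambda>k. k \<odot>\<^bsub>M\<^esub> x) ` K \<in> degree_submodules Rc M {\<zero>\<^bsub>M\<^esub>} (Mc d)"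
  unfolding degree_submodules_def
proof (intro CollectI conjI ballI)
  let ?f = "\<lambda>K. (\<lambda>k. k \<odot>\<^bsub>M\<^esub> x) ` K"
  have xc: "x \<in> carrier M" using x MD.Ac_closed by blast
  note D = ring_degree_submodulesD[OF K]
  have Kc: "k \<in> carrier R" if "k \<in> K" for k using that D(2) RD.Ac_closed by blast
  show zero: "\<zero>\<^bsub>M\<^esub> \<in> ?f K" using D(3) xc by (intro image_eqI[of _ _ \<zero>]) simp_all
  then show "{\<zero>\<^bsub>M\<^esub>} \<subseteq> ?f K" by simp
  show "?f K \<subseteq> Mc d"
  proof (rule image_subsetI)
    show "k \<odot>\<^bsub>M\<^esub> x \<in> Mc d" if "k \<in> K" for k using smult_mem[OF _ x, of k 0] D(2) that by auto
  qed
  show "y \<oplus>\<^bsub>M\<^esub> z \<in> ?f K" if yz: "y \<in> ?f K" "z \<in> ?f K" for y z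
  proof -
    obtain k l where kl: "k \<in> K" "l \<in> K" "y = k \<odot>\<^bsub>M\<^esub> x" "z = l \<odot>\<^bsub>M\<^esub> x" using yz by blast
    then have "y \<oplus>\<^bsub>M\<^esub> z = (k \<oplus> l) \<odot>\<^bsub>M\<^esub> x" using Kc xc by (simp add: smult_l_distr)
    then show ?thesis using D(4)[OF kl(1,2)] by blast
  qed
  show "r \<odot>\<^bsub>M\<^esub> y \<in> ?f K" if r: "r \<in> Rc 0" and y: "y \<in> ?f K" for r y
  proof -
    obtain k where k: "k \<in> K" "y = k \<odot>\<^bsub>M\<^esub> x" using y by blast
    then have "r \<odot>\<^bsub>M\<^esub> y = (r \<otimes> k) \<odot>\<^bsub>M\<^esub> x" using Kc xc RD.Ac_closed[OF r] by (simp add: smult_assoc1)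
    then show ?thesis using D(5)[OF r k(1)] by blast
  qed
qed

text \<open>Multiplication of \<open>C\<close> by \<open>x\<close> has its kernel inside
  \<open>B\<close>, and every submodule in the interval contains \<open>B\<close>, so it can be
  recovered from its image.\<close>

lemma ring_len_le_len:
  assumes C: "C \<in> degree_submodules Rc (self_module R) B (Rc 0)" and x: "x \<in> Mc d"
    and B: "\<And>c. c \<in> C \<Longrightarrow> c \<odot>\<^bsub>M\<^esub> x = \<zero>\<^bsub>M\<^esub> \<Longrightarrow> c \<in> B"
  shows "ring_len B C \<le> len {\<zero>\<^bsub>M\<^esub>} (Mc d)"
proof (rule height_le_image)
  have xc: "x \<in> carrier M" using x MD.Ac_closed by blast
  have C0: "C \<subseteq> Rc 0" by (rule ring_degree_submodulesD(2)[OF C])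
  have up: "K \<in> degree_submodules Rc (self_module R) B (Rc 0)"
    if "K \<in> degree_submodules Rc (self_module R) B C" for K
    using that C0 by (auto simp: degree_submodules_def)
  show "(\<lambda>k. k \<odot>\<^bsub>M\<^esub> x) ` K \<in> degree_submodules Rc M {\<zero>\<^bsub>M\<^esub>} (Mc d)"
    if "K \<in> degree_submodules Rc (self_module R) B C" for K
    by (rule smult_image_degree_submodules[OF up[OF that] x])
  show "(\<lambda>k. k \<odot>\<^bsub>M\<^esub> x) ` K \<le> (\<lambda>k. k \<odot>\<^bsub>M\<^esub> x) ` K'" if "K \<le> K'" for K K' using that by blast
  show "inj_on (\<lambda>K. (\<lambda>k. k \<odot>\<^bsub>M\<^esub> x) ` K) (degree_submodules Rc (self_module R) B C)"
  proof (rule inj_onI)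
    have *: "K \<subseteq> K'"
      if K: "K \<in> degree_submodules Rc (self_module R) B C" and K': "K' \<in> degree_submodules Rc (self_module R) B C"
        and eq: "(\<lambda>k. k \<odot>\<^bsub>M\<^esub> x) ` K = (\<lambda>k. k \<odot>\<^bsub>M\<^esub> x) ` K'" for K K'
    proof
      fix k assume k: "k \<in> K"
      then obtain k' where k': "k' \<in> K'" "k \<odot>\<^bsub>M\<^esub> x = k' \<odot>\<^bsub>M\<^esub> x" using eq by blast
      have kC: "k \<in> C" "k' \<in> C" using k k'(1) ring_degree_submodulesD(2) K K' by blast+
      have c: "k \<in> carrier R" "k' \<in> carrier R" using kC C0 RD.Ac_closed by blast+
      have "(k \<ominus> k') \<odot>\<^bsub>M\<^esub> x = \<zero>\<^bsub>M\<^esub>"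
        using c xc k'(2) by (simp add: a_minus_def smult_l_distr smult_l_minus M.r_neg)
      moreover have "k \<ominus> k' \<in> C"
        by (rule ring_degree_submodules_minus[OF C _ kC]) (use RD.Ac_closed in blast)
      ultimately have "k \<ominus> k' \<in> K'" using B ring_degree_submodulesD(1)[OF K'] by blast
      then have "(k \<ominus> k') \<oplus> k' \<in> K'" using ring_degree_submodulesD(4)[OF K' _ k'(1)] by blast
      then show "k \<in> K'" using c by (simp add: minus_add_cancel)
    qed
    fix K K' assume "K \<in> degree_submodules Rc (self_module R) B C" "K' \<in> degree_submodules Rc (self_module R) B C"
      "(\<lambda>k. k \<odot>\<^bsub>M\<^esub> x) ` K = (\<lambda>k. k \<odot>\<^bsub>M\<^esub> x) ` K'"
    then show "K = K'" using *[of K K'] *[of K' K] by (metis subset_antisym)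
  qed
qed

definition degree_zero_ann :: "('g \<times> 'b) set \<Rightarrow> 'a set"
  where "degree_zero_ann E = {r\<in>Rc 0. \<forall>(t, x)\<in>E. r \<odot>\<^bsub>M\<^esub> x = \<zero>\<^bsub>M\<^esub>}"

lemma degree_zero_ann_degree_submodules:
  assumes E: "\<And>t x. (t, x) \<in> E \<Longrightarrow> x \<in> Mc t" and B: "B \<subseteq> degree_zero_ann E"
  shows "degree_zero_ann E \<in> degree_submodules Rc (self_module R) B (Rc 0)"
proof -
  have E': "\<And>t x. (t, x) \<in> E \<Longrightarrow> x \<in> carrier M" using E MD.Ac_closed by blast
  have "r \<otimes> s \<in> Rc 0" if "r \<in> Rc 0" "s \<in> Rc 0" for r s
    using ring_mult_degree[OF _ _ that] by simp
  then show ?thesis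
    using B E' RD.zero_in_Ac RD.add_in_Ac RD.Ac_closed
    by (auto simp: degree_submodules_def degree_zero_ann_def smult_l_distr smult_assoc1 split: prod.splits)
qed

text \<open>Embeds R_0 modulo an annihilator into a sum of components without forming the sum: when
  a generator x of degree d is added, the annihilator shrinks by a quotient that r \<mapsto> rx
  embeds into the component in degree d.\<close>

lemma ring_len_finite_of_len_finite:
  assumes fin: "\<And>t. len {\<zero>\<^bsub>M\<^esub>} (Mc t) < \<infinity>"
    and E: "finite E" "\<And>t x. (t, x) \<in> E \<Longrightarrow> x \<in> Mc t"
  shows "ring_len (degree_zero_ann E) (Rc 0) < \<infinity>"
  using E
proof (induction E)
  case empty
  have "degree_zero_ann {} = Rc 0" by (simp add: degree_zero_ann_def)
  then have "ring_len (degree_zero_ann {}) (Rc 0) = 0"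
    by (intro height_singleton[of _ "Rc 0"]) (auto simp: degree_submodules_def)
  then show ?case by simp
next
  case (insert p E)
  interpret S: full_graded_module R Rc "self_module R" Rc by (rule full_graded_self_module)
  obtain d x where p: "p = (d, x)" by fastforce
  let ?A = "degree_zero_ann (insert p E)" and ?B = "degree_zero_ann E"
  have AB: "?A \<subseteq> ?B" by (auto simp: degree_zero_ann_def)
  have B: "?B \<in> degree_submodules Rc (self_module R) ?A (Rc 0)"
    by (rule degree_zero_ann_degree_submodules) (use insert.prems AB in auto)
  have "ring_len ?A ?B \<le> len {\<zero>\<^bsub>M\<^esub>} (Mc d)"
    by (rule ring_len_le_len[OF B, of x]) (use insert.prems p in \<open>auto simp: degree_zero_ann_def\<close>)
  also have "\<dots> < \<infinity>" by (rule fin)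
  finally have 1: "ring_len ?A ?B < \<infinity>" .
  have 2: "ring_len ?B (Rc 0) < \<infinity>" using insert by blast
  have "degree_zero_ann {} \<in> degree_submodules Rc (self_module R) ?A (Rc 0)"
    by (rule degree_zero_ann_degree_submodules) (auto simp: degree_zero_ann_def)
  then have "Rc 0 \<in> degree_submodules Rc (self_module R) ?A (Rc 0)" by (simp add: degree_zero_ann_def)
  then have "ring_len ?A (Rc 0) = ring_len ?A ?B + ring_len ?B (Rc 0)"
    by (intro S.len_additive[OF B]) (use RD.Ac_closed in auto)
  then show ?case using 1 2 by auto
qed

text \<open>Finite generation of the component enters as the ascending chain condition. If a largest
  submodule \<open>H\<close> of finite length missed some y, then (H + R_0 y)/H would be a quotient
  of R_0/I, hence of finite length, and \<open>H\<close> could be enlarged.\<close>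

lemma len_finite_of_ring_len_finite:
  assumes acc: "acc {N. hom_submod N}" and fin: "ring_len I (Rc 0) < \<infinity>"
    and I: "\<And>r x. r \<in> I \<Longrightarrow> x \<in> Mc t \<Longrightarrow> r \<odot>\<^bsub>M\<^esub> x = \<zero>\<^bsub>M\<^esub>" "I \<subseteq> Rc 0"
  shows "len {\<zero>\<^bsub>M\<^esub>} (Mc t) < \<infinity>"
proof -
  let ?S = "degree_submodules Rc M {\<zero>\<^bsub>M\<^esub>} (Mc t)"
  have Mc_sub: "Mc t \<subseteq> carrier M" using MD.Ac_closed by blast
  have "{\<zero>\<^bsub>M\<^esub>} \<in> ?S" using hom_submod_degree[OF hom_submod_zero, where B = "{\<zero>\<^bsub>M\<^esub>}" and C = "Mc t"] MD.zero_in_Ac by simp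
  moreover have "len {\<zero>\<^bsub>M\<^esub>} {\<zero>\<^bsub>M\<^esub>} = 0"
    by (rule height_singleton[of _ "{\<zero>\<^bsub>M\<^esub>}"]) (auto simp: degree_submodules_def)
  then have "len {\<zero>\<^bsub>M\<^esub>} {\<zero>\<^bsub>M\<^esub>} < \<infinity>" by (auto simp: zero_enat_def)
  ultimately have "{\<zero>\<^bsub>M\<^esub>} \<in> {K\<in>?S. len {\<zero>\<^bsub>M\<^esub>} K < \<infinity>}" by blast
  then have "\<exists>K\<in>{K\<in>?S. len {\<zero>\<^bsub>M\<^esub>} K < \<infinity>}. \<forall>L\<in>{K\<in>?S. len {\<zero>\<^bsub>M\<^esub>} K < \<infinity>}. \<not> K < L"
    by (intro acc_maximal[OF acc_degree_submodules[OF acc]]) blast+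
  then obtain H where "H \<in> {K\<in>?S. len {\<zero>\<^bsub>M\<^esub>} K < \<infinity>}" "\<forall>L\<in>{K\<in>?S. len {\<zero>\<^bsub>M\<^esub>} K < \<infinity>}. \<not> H < L"
    by (rule bexE)
  then have H: "H \<in> ?S" "len {\<zero>\<^bsub>M\<^esub>} H < \<infinity>" "\<And>L. L \<in> ?S \<Longrightarrow> len {\<zero>\<^bsub>M\<^esub>} L < \<infinity> \<Longrightarrow> \<not> H < L"
    by simp_all
  note DH = degree_submodulesD[OF H(1)]
  show ?thesis
  proof (cases "H = Mc t")
    case False
    then obtain y where y: "y \<in> Mc t" "y \<notin> H" using DH(2) by blast
    have yc: "y \<in> carrier M" using y Mc_sub by blast
    let ?Y = "(\<lambda>r. r \<odot>\<^bsub>M\<^esub> y) ` Rc 0"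
    let ?L = "sum_set H ?Y"
    have "degree_zero_ann {} \<in> degree_submodules Rc (self_module R) {} (Rc 0)"
      by (rule degree_zero_ann_degree_submodules) auto
    then have "Rc 0 \<in> degree_submodules Rc (self_module R) {} (Rc 0)" by (simp add: degree_zero_ann_def)
    then have Y: "?Y \<in> ?S" by (rule smult_image_degree_submodules[OF _ y(1)])
    note DY = degree_submodulesD[OF Y]
    have sub: "H \<subseteq> ?L" "?Y \<subseteq> ?L"
      using subset_sum_set[OF DH(3) DY(3)] DH(2) DY(2) Mc_sub by blast+
    have "?L \<subseteq> Mc t"
      unfolding sum_set_def using MD.add_in_Ac[OF subsetD[OF DH(2)] subsetD[OF DY(2)]] by blast
    then have L: "?L \<in> ?S"
      using sum_set_degree_submodules[OF H(1) Y Mc_sub Mc_sub, of "{\<zero>\<^bsub>M\<^esub>}" "Mc t"] sub(1) DH(1) by blast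
    note DL = degree_submodulesD[OF L]
    have "\<one> \<odot>\<^bsub>M\<^esub> y = y" using yc by simp
    then have "y \<in> ?Y" using one_degree by (metis image_eqI)
    then have less: "H < ?L" using sub y(2) by blast
    have "len H ?L \<le> ring_len I (Rc 0)"
    proof (rule height_le_image)
      \<comment> \<open>The scalars taking \<open>y\<close> into \<open>K\<close>. They include
        \<open>I\<close>, which kills \<open>y\<close>, and they determine \<open>K\<close> because
        \<open>y\<close> generates the larger submodule over \<open>H\<close>.\<close>
      let ?f = "\<lambda>K. {r\<in>Rc 0. r \<odot>\<^bsub>M\<^esub> y \<in> K}"
      show "?f K \<le> ?f K'" if "K \<le> K'" for K K' using that by blast
      show "?f K \<in> degree_submodules Rc (self_module R) I (Rc 0)" if K: "K \<in> degree_submodules Rc M H ?L" for K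
      proof -
        note D = degree_submodulesD[OF K]
        have "r \<otimes> s \<in> Rc 0" if "r \<in> Rc 0" "s \<in> Rc 0" for r s
          using ring_mult_degree[OF _ _ that] by simp
        moreover have "I \<subseteq> ?f K" using I y(1) D(3) by auto
        ultimately show ?thesis
          using D(3,4,5) yc RD.zero_in_Ac RD.add_in_Ac RD.Ac_closed
          by (auto simp: degree_submodules_def smult_l_distr smult_assoc1)
      qed
      show "inj_on ?f (degree_submodules Rc M H ?L)"
      proof (rule inj_onI)
        have *: "K \<subseteq> K'"
          if K: "K \<in> degree_submodules Rc M H ?L" and K': "K' \<in> degree_submodules Rc M H ?L"
            and eq: "?f K = ?f K'" for K K'
        proof
          fix z assume z: "z \<in> K"
          then obtain l r where lr: "l \<in> H" "r \<in> Rc 0" "z = l \<oplus>\<^bsub>M\<^esub> r \<odot>\<^bsub>M\<^esub> y"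
            using degree_submodulesD(2)[OF K] by (auto simp: sum_set_def)
          have lK: "l \<in> K" "l \<in> K'" using lr(1) degree_submodulesD(1) K K' by blast+
          have "r \<odot>\<^bsub>M\<^esub> y \<in> K"
          proof (rule degree_submodules_cancel[OF K _ lK(1)])
            show "?L \<subseteq> carrier M" using DL(2) Mc_sub by blast
            show "l \<oplus>\<^bsub>M\<^esub> r \<odot>\<^bsub>M\<^esub> y \<in> K" using z lr(3) by simp
            show "r \<odot>\<^bsub>M\<^esub> y \<in> carrier M" using lr(2) yc RD.Ac_closed by blast
          qed
          then have "r \<in> ?f K'" using lr(2) eq by blast
          then have "r \<odot>\<^bsub>M\<^esub> y \<in> K'" by simp
          then show "z \<in> K'" using degree_submodulesD(4)[OF K' lK(2)] lr(3) by simp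
        qed
        fix K K' assume "K \<in> degree_submodules Rc M H ?L" "K' \<in> degree_submodules Rc M H ?L" "?f K = ?f K'"
        then show "K = K'" using *[of K K'] *[of K' K] by (metis subset_antisym)
      qed
    qed
    then have "len H ?L < \<infinity>" using fin by (rule order_le_less_trans)
    moreover have "len {\<zero>\<^bsub>M\<^esub>} ?L = len {\<zero>\<^bsub>M\<^esub>} H + len H ?L"
    proof (rule len_additive)
      show "H \<in> degree_submodules Rc M {\<zero>\<^bsub>M\<^esub>} ?L" "?L \<in> degree_submodules Rc M {\<zero>\<^bsub>M\<^esub>} ?L"
        using H(1) L sub by (auto simp: degree_submodules_def)
      show "?L \<subseteq> carrier M" using DL(2) Mc_sub by blast
    qed
    ultimately have "len {\<zero>\<^bsub>M\<^esub>} ?L < \<infinity>" using H(2) by auto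
    then show ?thesis using H(3)[OF L] less by blast
  qed (use H in simp)
qed

section \<open>The Artinian criterion\<close>

lemma ann_ideal: "ideal (ann R M) R"
  by (rule ideal_of_closed) (auto simp: ann_def smult_l_distr smult_assoc1)

text \<open>The degree 0 part of R/I is R_0 modulo its intersection with \<open>I\<close>. Image and
  preimage under the quotient map are mutually inverse between its ideals and \<open>?S\<close>, and
  both preserve inclusion, so descending chains transfer either way.\<close>

lemma artinian_quotient_iff:
  assumes I: "ideal I R"
  shows "artinian_ring ((R Quot I)\<lparr>carrier := quotient_grading R I Rc 0\<rparr>) \<longleftrightarrow>
    dcc (degree_submodules Rc (self_module R) (I \<inter> Rc 0) (Rc 0))"
    (is "artinian_ring ?Q \<longleftrightarrow> dcc ?S")
proof -
  interpret I: ideal I R by (rule I)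
  interpret h: ring_hom_ring R "R Quot I" "(+>) I" by (rule I.rcos_ring_hom_ring)
  interpret Quot: cring "R Quot I" by (rule I.quotient_is_cring) (rule cring_axioms)
  let ?h = "\<lambda>r. I +> r"
  have R0: "r \<in> carrier R" if "r \<in> Rc 0" for r using that RD.Ac_closed by blast
  have mult0: "r \<otimes> s \<in> Rc 0" if "r \<in> Rc 0" "s \<in> Rc 0" for r s
    using ring_mult_degree[OF _ _ that] by simp
  have "subring (Rc 0) R"
  proof (rule subringI)
    show "\<ominus> r \<in> Rc 0" if "r \<in> Rc 0" for r
      using mult0[OF minus_one_degree that] R0[OF that] by (simp add: l_minus)
  qed (use R0 one_degree mult0 RD.add_in_Ac in auto)
  then have "subring (?h ` Rc 0) (R Quot I)" by (rule h.img_is_subring)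
  then have "subcring (?h ` Rc 0) (R Quot I)" by (rule Quot.subcringI')
  then have cring: "cring ?Q"
    using ring.subcring_iff[OF I.quotient_is_ring, of "?h ` Rc 0"] R0 h.hom_closed
    by (simp add: quotient_grading_def image_subset_iff)
  have phi: "ideal (?h ` K) ?Q" if K: "K \<in> ?S" for K
  proof -
    note D = ring_degree_submodulesD[OF K]
    interpret Q: cring ?Q by (rule cring)
    have Kc: "k \<in> carrier R" if "k \<in> K" for k using that D(2) R0 by blast
    show ?thesis
    proof (rule Q.ideal_of_closed)
      show "?h ` K \<subseteq> carrier ?Q" using D(2) by (auto simp: quotient_grading_def)
      have "\<zero>\<^bsub>?Q\<^esub> = ?h \<zero>" using h.hom_zero by simp
      then show "\<zero>\<^bsub>?Q\<^esub> \<in> ?h ` K" using D(3) by blast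
      show "a \<oplus>\<^bsub>?Q\<^esub> b \<in> ?h ` K" if ab: "a \<in> ?h ` K" "b \<in> ?h ` K" for a b
      proof -
        obtain k l where kl: "k \<in> K" "l \<in> K" "a = ?h k" "b = ?h l" using ab by blast
        then have "a \<oplus>\<^bsub>?Q\<^esub> b = ?h (k \<oplus> l)" using Kc by simp
        then show ?thesis using D(4)[OF kl(1,2)] by blast
      qed
      show "x \<otimes>\<^bsub>?Q\<^esub> a \<in> ?h ` K" if ax: "a \<in> ?h ` K" "x \<in> carrier ?Q" for a x
      proof -
        obtain k r where kr: "k \<in> K" "r \<in> Rc 0" "a = ?h k" "x = ?h r"
          using ax by (auto simp: quotient_grading_def)
        then have "x \<otimes>\<^bsub>?Q\<^esub> a = ?h (r \<otimes> k)" using Kc R0 by simp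
        then show ?thesis using D(5)[OF kr(2,1)] by blast
      qed
    qed
  qed
  let ?psi = "\<lambda>J. {r\<in>Rc 0. ?h r \<in> J}"
  have psi: "?psi J \<in> ?S" if J: "ideal J ?Q" for J
  proof -
    note add = additive_subgroup.a_closed[OF ideal.axioms(1)[OF J]]
      and zero_J = additive_subgroup.zero_closed[OF ideal.axioms(1)[OF J]]
    have zero: "?h r = \<zero>\<^bsub>?Q\<^esub>" if "r \<in> I" for r
    proof -
      have "r \<in> carrier R" using that by (rule I.a_Hcarr)
      then have "?h r = ?h \<zero>"
        using quotient_eq_iff_same_a_r_cos[OF I, of r \<zero>] that by (simp add: a_minus_def)
      then show ?thesis using h.hom_zero by simp
    qed
    show ?thesis
      unfolding degree_submodules_def
    proof (rule CollectI, intro conjI ballI)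
      show "I \<inter> Rc 0 \<subseteq> ?psi J" using zero zero_J by auto
      show "\<zero>\<^bsub>self_module R\<^esub> \<in> ?psi J" using zero[OF I.zero_closed] zero_J RD.zero_in_Ac by simp
      show "x \<oplus>\<^bsub>self_module R\<^esub> y \<in> ?psi J" if "x \<in> ?psi J" "y \<in> ?psi J" for x y
        using that add[of "?h x" "?h y"] RD.add_in_Ac R0 by simp
      show "r \<odot>\<^bsub>self_module R\<^esub> x \<in> ?psi J" if "r \<in> Rc 0" "x \<in> ?psi J" for r x
        using that ideal.I_l_closed[OF J, of "?h x" "?h r"] mult0 R0 by (simp add: quotient_grading_def)
    qed blast
  qed
  have psi_phi: "?psi (?h ` K) = K" if K: "K \<in> ?S" for K
  proof
    note D = ring_degree_submodulesD[OF K]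
    show "K \<subseteq> ?psi (?h ` K)" using D(2) by blast
    show "?psi (?h ` K) \<subseteq> K"
    proof
      fix r assume r: "r \<in> ?psi (?h ` K)"
      then obtain k where k: "k \<in> K" "?h r = ?h k" and r0: "r \<in> Rc 0" by blast
      have k0: "k \<in> Rc 0" using k(1) D(2) by blast
      \<comment> \<open>Equal cosets differ by an element of \<open>I\<close>; since both
        representatives have degree 0, the difference lies in \<open>K\<close>.\<close>
      have "r \<ominus> k \<in> I" using quotient_eq_iff_same_a_r_cos[OF I R0[OF r0] R0[OF k0]] k(2) by simp
      moreover have "r \<ominus> k \<in> Rc 0"
        using mult0[OF minus_one_degree k0] RD.add_in_Ac[OF r0] R0[OF k0] by (simp add: l_minus a_minus_def)
      ultimately have "(r \<ominus> k) \<oplus> k \<in> K" using D(1) D(4)[OF _ k(1)] by blast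
      then show "r \<in> K" using R0[OF r0] R0[OF k0] by (simp add: minus_add_cancel)
    qed
  qed
  have phi_psi: "?h ` ?psi J = J" if J: "ideal J ?Q" for J
  proof -
    have "J \<subseteq> ?h ` Rc 0"
      using additive_subgroup.a_subset[OF ideal.axioms(1)[OF J]] by (simp add: quotient_grading_def)
    then show ?thesis by blast
  qed
  show ?thesis
  proof
    assume "artinian_ring ?Q"
    then interpret A: artinian_ring ?Q .
    show "dcc ?S"
    proof (rule dccI)
      fix f :: "nat \<Rightarrow> 'a set" assume f: "\<And>i. f i \<in> ?S" "\<And>i. f (Suc i) < f i"
      obtain m where m: "\<forall>n\<ge>m. ?h ` f n = ?h ` f m"
        using A.descending_chain_condition[of "\<lambda>i. ?h ` f i", OF phi[OF f(1)] image_mono[OF less_imp_le[OF f(2)]]]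
        by blast
      have image: "?h ` f (Suc m) = ?h ` f m" using m[rule_format, of "Suc m"] by simp
      have "f (Suc m) = ?psi (?h ` f (Suc m))" by (rule psi_phi[OF f(1), symmetric])
      also have "\<dots> = ?psi (?h ` f m)" by (simp only: image)
      also have "\<dots> = f m" by (rule psi_phi[OF f(1)])
      finally show False using f(2)[of m] by (metis order_less_irrefl)
    qed
  next
    assume dcc: "dcc ?S"
    show "artinian_ring ?Q"
    proof (intro artinian_ring.intro[OF cring] artinian_ring_axioms.intro)
      fix J :: "nat \<Rightarrow> 'a set set" assume J: "\<And>n. ideal (J n) ?Q" "\<And>n. J (Suc n) \<subseteq> J n"
      have "\<exists>m. \<forall>n\<ge>m. ?psi (J n) = ?psi (J m)"
      proof (rule dcc_stabilizes[OF dcc])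
        show "?psi (J n) \<in> ?S" for n by (rule psi[OF J(1)])
        show "?psi (J (Suc n)) \<le> ?psi (J n)" for n using J(2)[of n] by blast
      qed
      then obtain m where m: "\<forall>n\<ge>m. ?psi (J n) = ?psi (J m)" by (rule exE)
      have "J n = J m" if "n \<ge> m" for n
      proof -
        have "J n = ?h ` ?psi (J n)" by (rule phi_psi[OF J(1), symmetric])
        also have "\<dots> = ?h ` ?psi (J m)" by (simp only: m[rule_format, OF that])
        also have "\<dots> = J m" by (rule phi_psi[OF J(1)])
        finally show ?thesis .
      qed
      then show "\<exists>m. \<forall>n\<ge>m. J n = J m" by blast
    qed
  qed
qed

text \<open>The length of R_0 modulo the degree 0 part of the annihilator mediates. It is finite
  exactly when the descending chain condition holds, the ascending one being inherited from
  \<open>R\<close>, and exactly when all components have finite length, by the two comparisons of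
  lengths.\<close>

lemma finite_len_iff_artinian:
  assumes "noetherian_ring R" "finitely_generated_module R M"
  shows "(\<forall>t. len {\<zero>\<^bsub>M\<^esub>} (Mc t) < \<infinity>) \<longleftrightarrow>
    artinian_ring ((R Quot ann R M)\<lparr>carrier := quotient_grading R (ann R M) Rc 0\<rparr>)"
proof -
  interpret S: full_graded_module R Rc "self_module R" Rc by (rule full_graded_self_module)
  let ?I = "ann R M \<inter> Rc 0"
  obtain E where E: "finite E" "\<And>t x. (t, x) \<in> E \<Longrightarrow> x \<in> Mc t"
    "\<And>N. hom_submod N \<Longrightarrow> (\<And>t x. (t, x) \<in> E \<Longrightarrow> x \<in> N t) \<Longrightarrow> N = Mc"
    using homogeneous_generators[OF assms(2)] by metis
  have ann_E: "degree_zero_ann E = ?I"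
  proof
    show "?I \<subseteq> degree_zero_ann E" using E(2) MD.Ac_closed by (fastforce simp: ann_def degree_zero_ann_def)
    show "degree_zero_ann E \<subseteq> ?I"
    proof
      fix r assume r: "r \<in> degree_zero_ann E"
      then have r0: "r \<in> Rc 0" and rE: "\<And>t x. (t, x) \<in> E \<Longrightarrow> r \<odot>\<^bsub>M\<^esub> x = \<zero>\<^bsub>M\<^esub>" by (auto simp: degree_zero_ann_def)
      have rc: "r \<in> carrier R" using r0 RD.Ac_closed by blast
      \<comment> \<open>The elements killed by \<open>r\<close> form a homogeneous submodule. As it
        contains the generators it is everything, so killing \<open>E\<close> means killing
        \<open>M\<close>.\<close>
      let ?N = "\<lambda>t. {x\<in>Mc t. r \<odot>\<^bsub>M\<^esub> x = \<zero>\<^bsub>M\<^esub>}"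
      have "r \<odot>\<^bsub>M\<^esub> (a \<odot>\<^bsub>M\<^esub> x) = \<zero>\<^bsub>M\<^esub>" if "a \<in> Rc g" "x \<in> Mc t" "r \<odot>\<^bsub>M\<^esub> x = \<zero>\<^bsub>M\<^esub>" for a g x t
      proof -
        have ac: "a \<in> carrier R" "x \<in> carrier M" using that RD.Ac_closed MD.Ac_closed by blast+
        then have "r \<odot>\<^bsub>M\<^esub> (a \<odot>\<^bsub>M\<^esub> x) = a \<odot>\<^bsub>M\<^esub> (r \<odot>\<^bsub>M\<^esub> x)"
          using rc by (simp add: smult_assoc1[symmetric] m_comm)
        then show ?thesis using that(3) ac by simp
      qed
      then have "hom_submod ?N"
        using rc MD.zero_in_Ac MD.add_in_Ac MD.Ac_closed smult_mem
        by (auto simp: homogeneous_submodule_def smult_r_distr)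
      then have N: "?N = Mc" by (rule E(3)) (use E(2) rE in auto)
      have "carrier M \<subseteq> {x\<in>carrier M. r \<odot>\<^bsub>M\<^esub> x = \<zero>\<^bsub>M\<^esub>}"
      proof (rule MD.carrier_subset_of_homogeneous)
        show "x \<in> {x\<in>carrier M. r \<odot>\<^bsub>M\<^esub> x = \<zero>\<^bsub>M\<^esub>}" if "x \<in> Mc t" for t x
          using that fun_cong[OF N, of t] MD.Ac_closed by blast
      qed (use rc in \<open>auto simp: smult_r_distr\<close>)
      then show "r \<in> ?I" using r0 rc by (auto simp: ann_def)
    qed
  qed
  let ?S = "degree_submodules Rc (self_module R) ?I (Rc 0)"
  have top: "Rc 0 \<in> ?S"
    using S.hom_submod_degree[OF S.hom_submod_Mc, of ?I 0 "Rc 0"] by simp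
  have bot: "?I \<in> ?S"
    using degree_zero_ann_degree_submodules[of E ?I] E(2) ann_E by simp
  have "?S \<subseteq> degree_submodules Rc (self_module R) {\<zero>\<^bsub>self_module R\<^esub>} (Rc 0)"
    by (auto simp: degree_submodules_def)
  moreover have "acc (degree_submodules Rc (self_module R) {\<zero>\<^bsub>self_module R\<^esub>} (Rc 0))"
    by (rule S.acc_degree_submodules[OF acc_homogeneous_ideals[OF assms(1)]])
  ultimately have accS: "acc ?S" by (rule acc_subset[rotated])
  have "dcc ?S \<longleftrightarrow> ring_len ?I (Rc 0) < \<infinity>"
    using S.len_finite_of_acc_dcc[OF bot top _ accS] height_finite_imp_dcc RD.Ac_closed by auto
  moreover have "ring_len ?I (Rc 0) < \<infinity> \<longleftrightarrow> (\<forall>t. len {\<zero>\<^bsub>M\<^esub>} (Mc t) < \<infinity>)"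
  proof
    assume fin: "ring_len ?I (Rc 0) < \<infinity>"
    show "\<forall>t. len {\<zero>\<^bsub>M\<^esub>} (Mc t) < \<infinity>"
    proof
      fix t
      show "len {\<zero>\<^bsub>M\<^esub>} (Mc t) < \<infinity>"
        by (rule len_finite_of_ring_len_finite[OF acc_hom_submod[OF assms] fin])
          (auto simp: ann_def MD.Ac_closed)
    qed
  next
    assume "\<forall>t. len {\<zero>\<^bsub>M\<^esub>} (Mc t) < \<infinity>"
    then show "ring_len ?I (Rc 0) < \<infinity>"
      using ring_len_finite_of_len_finite[OF _ E(1,2)] ann_E by simp
  qed
  ultimately show ?thesis using artinian_quotient_iff[OF ann_ideal] by blast
qed

end

section \<open>Summable series\<close>

text \<open>The coefficients of (1 - z^g) a(z).\<close>

definition shift_diff :: "'g::ab_group_add \<Rightarrow> ('g \<Rightarrow> int) \<Rightarrow> ('g \<Rightarrow> int)"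
  where "shift_diff g a = (\<lambda>t. a t - a (t - g))"

definition integral_vector :: "rat ^ 'd \<Rightarrow> bool"
  where "integral_vector g \<longleftrightarrow> (\<forall>i. g $ i \<in> \<int>)"

text \<open>Series whose product with some \<open>(1 - z\<^sup>g\<^sub>1) \<cdots> (1 - z\<^sup>g\<^sub>n)\<close>, where the \<open>g\<^sub>i\<close> are nonzero and
  integral, is a finite sum.\<close>

inductive almost_periodic :: "(rat ^ 'd \<Rightarrow> int) \<Rightarrow> bool" where
  finite_support: "finite {t. a t \<noteq> 0} \<Longrightarrow> almost_periodic a"
| step: "integral_vector g \<Longrightarrow> g \<noteq> 0 \<Longrightarrow> almost_periodic (shift_diff g a) \<Longrightarrow> almost_periodic a"

lemma finite_support_shift:
  fixes a :: "'g::ab_group_add \<Rightarrow> int"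
  assumes "finite {t. a t \<noteq> 0}"
  shows "finite {t. a (t - g) \<noteq> 0}"
proof -
  have "{t. a (t - g) \<noteq> 0} \<subseteq> (\<lambda>t. t + g) ` {t. a t \<noteq> 0}"
    by (auto simp: image_iff intro!: exI[of _ "_ - g"])
  with assms show ?thesis by (meson finite_imageI finite_subset)
qed

lemma almost_periodic_shift:
  "almost_periodic a \<Longrightarrow> almost_periodic (\<lambda>t. a (t - g))"
proof (induction rule: almost_periodic.induct)
  case (finite_support a)
  then show ?case by (intro almost_periodic.finite_support finite_support_shift)
next
  case (step h a)
  have "shift_diff h (\<lambda>t. a (t - g)) = (\<lambda>t. shift_diff h a (t - g))"
    by (simp add: shift_diff_def algebra_simps)
  with step show ?case by (metis almost_periodic.step)
qed

lemma almost_periodic_shift_diff: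
  "almost_periodic a \<Longrightarrow> almost_periodic (shift_diff g a)"
proof (induction rule: almost_periodic.induct)
  case (finite_support a)
  have "{t. shift_diff g a t \<noteq> 0} \<subseteq> {t. a t \<noteq> 0} \<union> {t. a (t - g) \<noteq> 0}"
    by (auto simp: shift_diff_def)
  then have "finite {t. shift_diff g a t \<noteq> 0}"
    using finite_support finite_support_shift[OF finite_support, of g] finite_subset by blast
  then show ?case by (rule almost_periodic.finite_support)
next
  case (step h a)
  have "shift_diff h (shift_diff g a) = shift_diff g (shift_diff h a)"
    by (simp add: shift_diff_def algebra_simps)
  with step show ?case by (metis almost_periodic.step)
qed

lemma shift_diff_add: "shift_diff g (\<lambda>t. a t + b t) = (\<lambda>t. shift_diff g a t + shift_diff g b t)"
  by (simp add: shift_diff_def algebra_simps)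

lemma almost_periodic_add_finite:
  assumes "almost_periodic b" "finite {t. a t \<noteq> 0}"
  shows "almost_periodic (\<lambda>t. a t + b t)"
  using assms
proof (induction arbitrary: a rule: almost_periodic.induct)
  case (finite_support b)
  have "{t. a t + b t \<noteq> 0} \<subseteq> {t. a t \<noteq> 0} \<union> {t. b t \<noteq> 0}" by auto
  then have "finite {t. a t + b t \<noteq> 0}"
    using finite_support by (meson finite_UnI finite_subset)
  then show ?case by (rule almost_periodic.finite_support)
next
  case (step h b)
  have "{t. shift_diff h a t \<noteq> 0} \<subseteq> {t. a t \<noteq> 0} \<union> {t. a (t - h) \<noteq> 0}"
    by (auto simp: shift_diff_def)
  then have fin: "finite {t. shift_diff h a t \<noteq> 0}"
    using step.prems finite_support_shift finite_subset by blast
  show ?case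
    by (rule almost_periodic.step[OF step.hyps(1,2)])
      (use step.IH[OF fin] in \<open>simp add: shift_diff_add\<close>)
qed

text \<open>The product of the factors for both summands works for the sum. Each factor taken off
  \<open>a\<close> is also applied to \<open>b\<close>, which stays almost periodic; the remaining
  case of finite support needs its own induction, on the other summand.\<close>

lemma almost_periodic_add:
  assumes "almost_periodic a" "almost_periodic b"
  shows "almost_periodic (\<lambda>t. a t + b t)"
  using assms
proof (induction arbitrary: b rule: almost_periodic.induct)
  case (finite_support a)
  then show ?case using almost_periodic_add_finite by blast
next
  case (step h a)
  show ?case
    by (rule almost_periodic.step[OF step.hyps(1,2)])
      (use step.IH[OF almost_periodic_shift_diff[OF step.prems]] in \<open>simp add: shift_diff_add\<close>)
qed

lemma integral_multiple:
  fixes g :: "rat ^ 'd"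
  obtains n where "n > 0" "integral_vector (of_nat n *s g)"
proof -
  have "\<exists>m::nat. m > 0 \<and> of_nat m * q \<in> \<int>" for q :: rat
  proof -
    obtain a b where ab: "quotient_of q = (a, b)" by (cases "quotient_of q")
    then have b: "b > 0" and q: "q = of_int a / of_int b"
      using quotient_of_denom_pos quotient_of_div by blast+
    then have "of_nat (nat b) * q = of_int a" by simp
    then have "of_nat (nat b) * q \<in> \<int>" by (simp only: Ints_of_int)
    with b show ?thesis by (intro exI[of _ "nat b"]) auto
  qed
  then obtain m :: "rat \<Rightarrow> nat" where m: "\<And>q. m q > 0 \<and> of_nat (m q) * q \<in> \<int>" by metis
  \<comment> \<open>There are finitely many coordinates, so one multiplier for each can be collected
    in a single product.\<close>
  let ?n = "\<Prod>i\<in>UNIV. m (g $ i)"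
  have "of_nat ?n * g $ i \<in> \<int>" for i
  proof -
    have "?n = m (g $ i) * (\<Prod>j\<in>UNIV - {i}. m (g $ j))" by (rule prod.remove) auto
    then have "of_nat ?n * g $ i = of_nat (\<Prod>j\<in>UNIV - {i}. m (g $ j)) * (of_nat (m (g $ i)) * g $ i)"
      by (simp only: of_nat_mult) (simp only: ac_simps)
    also have "\<dots> \<in> \<int>" by (intro Ints_mult Ints_of_nat conjunct2[OF m])
    finally show ?thesis .
  qed
  then have "integral_vector (of_nat ?n *s g)"
    unfolding integral_vector_def vector_smult_component by blast
  moreover have "?n > 0" using m by (simp add: prod_pos)
  ultimately show thesis using that by blast
qed

text \<open>Integrality of \<open>g\<close> is harmless since \<open>1 - z\<^sup>g\<close> divides \<open>1 - z\<^sup>n\<^sup>g\<close>.\<close>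

lemma almost_periodic_rational_step:
  fixes a :: "rat ^ 'd \<Rightarrow> int"
  assumes "g \<noteq> 0" "almost_periodic (shift_diff g a)"
  shows "almost_periodic a"
proof -
  have multiple: "almost_periodic (shift_diff (of_nat n *s g) a)" for n
  proof (induction n)
    case 0
    show ?case by (intro almost_periodic.finite_support) (simp add: shift_diff_def)
  next
    case (Suc n)
    have "of_nat (Suc n) *s g = g + of_nat n *s g" by (simp add: vec_eq_iff algebra_simps)
    then have "shift_diff (of_nat (Suc n) *s g) a =
        (\<lambda>t. shift_diff g a t + shift_diff (of_nat n *s g) a (t - g))"
      by (simp add: shift_diff_def diff_diff_eq)
    then show ?case
      using almost_periodic_add[OF assms(2) almost_periodic_shift[OF Suc, of g]] by simp
  qed
  obtain n where "n > 0" "integral_vector (of_nat n *s g)" by (rule integral_multiple)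
  moreover have "of_nat n *s g \<noteq> 0" using \<open>n > 0\<close> assms(1) by simp
  ultimately show ?thesis using multiple almost_periodic.step by blast
qed

section \<open>From difference operators to a nonzero Laurent multiplier\<close>

lemma series_act_superset:
  assumes "finite S" "Poly_Mapping.keys b \<subseteq> S"
  shows "series_act b a t = (\<Sum>s\<in>S. Poly_Mapping.lookup b s * a (t - s))"
  unfolding series_act_def
  by (rule sum.mono_neutral_left) (use assms in \<open>auto simp: in_keys_iff\<close>)

lemma lookup_shifted:
  fixes b :: "'g::ab_group_add \<Rightarrow>\<^sub>0 int"
  obtains c where "\<And>t. Poly_Mapping.lookup c t = Poly_Mapping.lookup b (t - g)"
proof -
  have "finite {t. Poly_Mapping.lookup b (t - g) \<noteq> 0}"
    by (intro finite_support_shift) simp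
  then show thesis by (intro that[of "Abs_poly_mapping (\<lambda>t. Poly_Mapping.lookup b (t - g))"]) simp
qed

text \<open>If b works for (1 - z^g) a, then (1 - z^g) b works for a; in the code this is
  \<open>b - b'\<close> with b' = z^g b. It is nonzero: otherwise the support of b would be stable
  under translation by \<open>g\<close>, hence infinite, since the multiples of a nonzero rational
  vector are distinct.\<close>

lemma almost_periodic_imp_summable:
  assumes "almost_periodic a"
  shows "summable_series a"
  using assms
proof (induction rule: almost_periodic.induct)
  case (finite_support a)
  let ?b = "Poly_Mapping.single (0 :: rat ^ 'd) (1 :: int)"
  have "?b \<in> laurent_polynomials" "?b \<noteq> 0"
    by (auto simp: laurent_polynomials_def)
  moreover have "series_act ?b a = Poly_Mapping.lookup (Abs_poly_mapping a)"
    using finite_support by (simp add: series_act_def fun_eq_iff)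
  ultimately show ?case unfolding summable_series_def by blast
next
  case (step g a)
  then obtain b c where b: "b \<in> laurent_polynomials" "b \<noteq> 0"
    and c: "series_act b (shift_diff g a) = Poly_Mapping.lookup c"
    unfolding summable_series_def by blast
  obtain b' where b': "\<And>t. Poly_Mapping.lookup b' t = Poly_Mapping.lookup b (t - g)"
    using lookup_shifted by blast
  have keys': "Poly_Mapping.keys b' = (\<lambda>s. s + g) ` Poly_Mapping.keys b"
    by (auto simp: in_keys_iff b' image_iff intro!: bexI[of _ "_ - g"])
  have look: "Poly_Mapping.lookup (b - b') t = Poly_Mapping.lookup b t - Poly_Mapping.lookup b (t - g)" for t
    by (simp add: lookup_minus b')
  have act: "series_act (b - b') a = series_act b (shift_diff g a)"
  proof
    fix t
    let ?S = "Poly_Mapping.keys b \<union> Poly_Mapping.keys b'"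
    have "Poly_Mapping.keys (b - b') \<subseteq> ?S" by (rule keys_diff)
    then have "series_act (b - b') a t = (\<Sum>s\<in>?S. Poly_Mapping.lookup (b - b') s * a (t - s))"
      by (intro series_act_superset) auto
    also have "\<dots> = (\<Sum>s\<in>?S. Poly_Mapping.lookup b s * a (t - s)) - (\<Sum>s\<in>?S. Poly_Mapping.lookup b' s * a (t - s))"
      by (simp add: lookup_minus left_diff_distrib sum_subtractf)
    also have "\<dots> = series_act b a t - series_act b' a t"
      using series_act_superset[of ?S b a t] series_act_superset[of ?S b' a t] by simp
    also have "series_act b' a t = series_act b a (t - g)"
      unfolding series_act_def keys'
      by (subst sum.reindex) (auto simp: b' inj_on_def algebra_simps)
    also have "series_act b a t - series_act b a (t - g) = series_act b (shift_diff g a) t"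
      by (simp add: series_act_def shift_diff_def right_diff_distrib sum_subtractf algebra_simps)
    finally show "series_act (b - b') a t = series_act b (shift_diff g a) t" .
  qed
  have "b - b' \<in> laurent_polynomials"
    using b(1) step.hyps(1) keys_diff[of b b'] keys'
    by (auto simp: laurent_polynomials_def integral_vector_def dest!: subsetD)
  moreover have "b - b' \<noteq> 0"
  proof
    assume "b - b' = 0"
    then have per: "Poly_Mapping.lookup b t = Poly_Mapping.lookup b (t - g)" for t
      using look[of t] by simp
    obtain s where s: "Poly_Mapping.lookup b s \<noteq> 0"
      using b(2) by (metis lookup_zero poly_mapping_eqI)
    have "Poly_Mapping.lookup b (s + of_nat n *s g) \<noteq> 0" for n
    proof (induction n)
      case (Suc n)
      have "s + of_nat (Suc n) *s g - g = s + of_nat n *s g" by (simp add: vec_eq_iff algebra_simps)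
      then show ?case using Suc per[of "s + of_nat (Suc n) *s g"] by metis
    qed (use s in simp)
    then have "range (\<lambda>n::nat. s + of_nat n *s g) \<subseteq> Poly_Mapping.keys b"
      by (auto simp: in_keys_iff)
    moreover have "inj (\<lambda>n::nat. s + of_nat n *s g)"
      using step.hyps(2) by (auto intro!: injI simp: vec_eq_iff)
    ultimately show False
      using finite_keys finite_subset range_inj_infinite by metis
  qed
  ultimately show ?case unfolding summable_series_def using act c
    by (intro bexI[of _ "b - b'"] conjI exI[of _ c]) simp_all
qed

section \<open>Hilbert functions\<close>

context full_graded_module
begin

text \<open>The Hilbert function of the subquotient N/N', smaller submodule first. The conversion is
  faithful where the lengths are finite.\<close>

definition hilbert_fun :: "('g \<Rightarrow> 'b set) \<Rightarrow> ('g \<Rightarrow> 'b set) \<Rightarrow> 'g \<Rightarrow> int"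
  where "hilbert_fun N' N t = int (the_enat (len (N' t) (N t)))"

text \<open>The finite length of each component of \<open>M\<close> bounds every interval in it, so
  the additivity of lengths survives the passage from \<open>enat\<close> to integers.\<close>

lemma hilbert_fun_add:
  assumes fin: "\<And>t. len {\<zero>\<^bsub>M\<^esub>} (Mc t) < \<infinity>"
    and hom: "hom_submod A" "hom_submod B" "hom_submod C" and le: "A \<le> B" "B \<le> C"
  shows "hilbert_fun A C t = hilbert_fun A B t + hilbert_fun B C t"
proof -
  have le_t: "A t \<subseteq> B t" "B t \<subseteq> C t" using le by (auto simp: le_fun_def)
  have C: "C t \<subseteq> Mc t" using hom_submodD(1)[OF hom(3)] by blast
  have "len (A t) (C t) = len (A t) (B t) + len (B t) (C t)"
  proof (rule len_additive)
    show "B t \<in> degree_submodules Rc M (A t) (C t)" "C t \<in> degree_submodules Rc M (A t) (C t)"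
      using hom_submod_degree hom le_t by blast+
    show "C t \<subseteq> carrier M" using C MD.Ac_closed by blast
  qed
  moreover have "len (A t) (C t) < \<infinity>"
  proof -
    have "len (A t) (C t) \<le> len {\<zero>\<^bsub>M\<^esub>} (Mc t)"
      using C by (intro height_mono) (auto simp: degree_submodules_def)
    then show ?thesis using fin by (rule order_le_less_trans)
  qed
  ultimately show ?thesis
    by (cases "len (A t) (B t)"; cases "len (B t) (C t)") (auto simp: hilbert_fun_def)
qed

lemma hilbert_fun_eq_0:
  assumes "N t \<subseteq> N' t"
  shows "hilbert_fun N' N t = 0"
proof -
  have "len (N' t) (N t) = 0"
    by (rule height_singleton[of _ "N t"]) (use assms in \<open>auto simp: degree_submodules_def\<close>)
  then show ?thesis by (simp add: hilbert_fun_def zero_enat_def)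
qed

text \<open>An element whose annihilator modulo \<open>L\<close> is maximal has a prime annihilator.\<close>

lemma exists_prime_colon:
  assumes accR: "acc {J. hom_ideal J}" and L: "hom_submod L" and N: "hom_submod N"
    and less: "L \<le> N" "L \<noteq> N"
  obtains d x where "x \<in> N d" "x \<notin> L d"
    "\<And>f g r h. f \<in> Rc g \<Longrightarrow> f \<odot>\<^bsub>M\<^esub> x \<notin> L (g + d) \<Longrightarrow> r \<in> Rc h \<Longrightarrow>
      r \<odot>\<^bsub>M\<^esub> (f \<odot>\<^bsub>M\<^esub> x) \<in> L (h + (g + d)) \<Longrightarrow> r \<odot>\<^bsub>M\<^esub> x \<in> L (h + d)"
proof -
  let ?T = "{colon L d x | d x. x \<in> N d \<and> x \<notin> L d}"
  obtain d0 where "\<not> N d0 \<subseteq> L d0" using less by (auto simp: fun_eq_iff le_fun_def)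
  then obtain x0 where "x0 \<in> N d0" "x0 \<notin> L d0" by blast
  then have ne: "?T \<noteq> {}" by blast
  have sub: "?T \<subseteq> {J. hom_ideal J}" using hom_ideal_colon[OF L] hom_submodD(2)[OF N] by blast
  obtain P where P: "P \<in> ?T" "\<forall>Q\<in>?T. \<not> P < Q" using acc_maximal[OF accR sub ne] by (rule bexE)
  then obtain d x where x: "P = colon L d x" "x \<in> N d" "x \<notin> L d" by blast
  have xc: "x \<in> carrier M" using x(2) hom_submodD(2)[OF N] by blast
  show thesis
  proof (rule that[OF x(2,3)])
    fix f g r h assume f: "f \<in> Rc g" "f \<odot>\<^bsub>M\<^esub> x \<notin> L (g + d)"
      and r: "r \<in> Rc h" "r \<odot>\<^bsub>M\<^esub> (f \<odot>\<^bsub>M\<^esub> x) \<in> L (h + (g + d))"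
    let ?Q = "colon L (g + d) (f \<odot>\<^bsub>M\<^esub> x)"
    have "f \<odot>\<^bsub>M\<^esub> x \<in> N (g + d)" by (rule hom_submodD(5)[OF N f(1) x(2)])
    then have "?Q \<in> ?T" using f(2) by blast
    then have "\<not> P < ?Q" using P(2) by blast
    moreover have "P \<le> ?Q"
    proof (intro le_funI subsetI)
      fix h s assume "s \<in> P h"
      then have s: "s \<in> Rc h" "s \<odot>\<^bsub>M\<^esub> x \<in> L (h + d)" by (auto simp: x(1) colon_def)
      have "f \<odot>\<^bsub>M\<^esub> (s \<odot>\<^bsub>M\<^esub> x) \<in> L (g + (h + d))" by (rule hom_submodD(5)[OF L f(1) s(2)])
      moreover have "f \<odot>\<^bsub>M\<^esub> (s \<odot>\<^bsub>M\<^esub> x) = s \<odot>\<^bsub>M\<^esub> (f \<odot>\<^bsub>M\<^esub> x)"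
        using RD.Ac_closed[OF f(1)] RD.Ac_closed[OF s(1)] xc by (simp add: smult_assoc1[symmetric] m_comm)
      ultimately show "s \<in> ?Q h" using s(1) by (simp add: colon_def add.left_commute)
    qed
    ultimately have "?Q = P" by (metis order_le_imp_less_or_eq)
    moreover have "r \<in> ?Q h" using r by (simp add: colon_def)
    ultimately show "r \<odot>\<^bsub>M\<^esub> x \<in> L (h + d)" by (simp add: x(1) colon_def)
  qed
qed

text \<open>Multiplication by \<open>f\<close> maps (L + Rx)/L in degree t isomorphically to (L +
  Rfx)/L in degree g + t: it is onto by construction and injective by \<open>inj\<close>. On
  intervals it becomes K \<mapsto> L + fK, with preimage in the other direction; each map is
  monotone and injective and yields one inequality.\<close>

lemma len_adjoin_multiple:
  assumes L: "hom_submod L" and x: "x \<in> Mc d" and f: "f \<in> Rc g"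
    and inj: "\<And>r h. r \<in> Rc h \<Longrightarrow> r \<odot>\<^bsub>M\<^esub> (f \<odot>\<^bsub>M\<^esub> x) \<in> L (h + (g + d)) \<Longrightarrow> r \<odot>\<^bsub>M\<^esub> x \<in> L (h + d)"
  shows "len (L t) (adjoin L d x t) = len (L (g + t)) (adjoin L (g + d) (f \<odot>\<^bsub>M\<^esub> x) (g + t))"
proof -
  let ?L2 = "adjoin L d x" and ?L3 = "adjoin L (g + d) (f \<odot>\<^bsub>M\<^esub> x)"
  let ?S = "degree_submodules Rc M (L t) (?L2 t)" and ?T = "degree_submodules Rc M (L (g + t)) (?L3 (g + t))"
  have fx: "f \<odot>\<^bsub>M\<^esub> x \<in> Mc (g + d)" by (rule smult_mem[OF f x])
  have L2: "hom_submod ?L2" by (rule hom_submod_adjoin[OF L x])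
  have L3: "hom_submod ?L3" by (rule hom_submod_adjoin[OF L fx])
  have c: "f \<in> carrier R" "x \<in> carrier M" using f x RD.Ac_closed MD.Ac_closed by blast+
  have carr: "?L2 t \<subseteq> carrier M" "?L3 (g + t) \<subseteq> carrier M"
    using hom_submodD(2)[OF L2] hom_submodD(2)[OF L3] by blast+
  have swap: "f \<odot>\<^bsub>M\<^esub> (r \<odot>\<^bsub>M\<^esub> x) = r \<odot>\<^bsub>M\<^esub> (f \<odot>\<^bsub>M\<^esub> x)" if "r \<in> Rc h" for r h
    using RD.Ac_closed[OF that] c by (simp add: smult_assoc1[symmetric] m_comm)
  have deg: "g + t - (g + d) = t - d" by simp
  have fL2: "f \<odot>\<^bsub>M\<^esub> y \<in> ?L3 (g + t)" if y: "y \<in> ?L2 t" for y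
  proof -
    obtain l r where lr: "l \<in> L t" "r \<in> Rc (t - d)" "y = l \<oplus>\<^bsub>M\<^esub> r \<odot>\<^bsub>M\<^esub> x" using y by (auto simp: adjoin_def)
    have "f \<odot>\<^bsub>M\<^esub> y = f \<odot>\<^bsub>M\<^esub> l \<oplus>\<^bsub>M\<^esub> r \<odot>\<^bsub>M\<^esub> (f \<odot>\<^bsub>M\<^esub> x)"
      using lr(3) hom_submodD(2)[OF L lr(1)] c RD.Ac_closed[OF lr(2)] swap[OF lr(2)] by (simp add: smult_r_distr)
    then show ?thesis
      unfolding adjoin_def deg using hom_submodD(5)[OF L f lr(1)] lr(2) by blast
  qed
  have injL: "y \<in> L t" if y: "y \<in> ?L2 t" and fy: "f \<odot>\<^bsub>M\<^esub> y \<in> L (g + t)" for y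
  proof -
    obtain l r where lr: "l \<in> L t" "r \<in> Rc (t - d)" "y = l \<oplus>\<^bsub>M\<^esub> r \<odot>\<^bsub>M\<^esub> x" using y by (auto simp: adjoin_def)
    have rx: "r \<odot>\<^bsub>M\<^esub> (f \<odot>\<^bsub>M\<^esub> x) \<in> carrier M" using RD.Ac_closed[OF lr(2)] c by simp
    have "f \<odot>\<^bsub>M\<^esub> l \<oplus>\<^bsub>M\<^esub> r \<odot>\<^bsub>M\<^esub> (f \<odot>\<^bsub>M\<^esub> x) \<in> L (g + t)"
      using fy lr(3) hom_submodD(2)[OF L lr(1)] c RD.Ac_closed[OF lr(2)] swap[OF lr(2)] by (simp add: smult_r_distr)
    then have "r \<odot>\<^bsub>M\<^esub> (f \<odot>\<^bsub>M\<^esub> x) \<in> L (g + t)"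
      using hom_submod_cancel[OF L hom_submodD(5)[OF L f lr(1)] _ rx] by blast
    then have "r \<odot>\<^bsub>M\<^esub> (f \<odot>\<^bsub>M\<^esub> x) \<in> L ((t - d) + (g + d))" by (simp add: algebra_simps)
    then have "r \<odot>\<^bsub>M\<^esub> x \<in> L (t - d + d)" by (rule inj[OF lr(2)])
    then have "r \<odot>\<^bsub>M\<^esub> x \<in> L t" by simp
    then show ?thesis unfolding lr(3) by (rule hom_submodD(4)[OF L lr(1)])
  qed
  \<comment> \<open>The image of \<open>K\<close> need not contain \<open>L\<close> in degree g + t,
    so it is treated as a submodule above zero and \<open>L\<close> is added afterwards.\<close>
  have image: "(\<lambda>y. f \<odot>\<^bsub>M\<^esub> y) ` K \<in> degree_submodules Rc M {\<zero>\<^bsub>M\<^esub>} (?L3 (g + t))" if K: "K \<in> ?S" for K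
  proof -
    note D = degree_submodulesD[OF K]
    have Kc: "k \<in> carrier M" if "k \<in> K" for k using that D(2) carr(1) by blast
    have "\<zero>\<^bsub>M\<^esub> = f \<odot>\<^bsub>M\<^esub> \<zero>\<^bsub>M\<^esub>" using c by simp
    then have zero: "\<zero>\<^bsub>M\<^esub> \<in> (\<lambda>y. f \<odot>\<^bsub>M\<^esub> y) ` K" using D(3) by (rule image_eqI)
    have add: "u \<oplus>\<^bsub>M\<^esub> v \<in> (\<lambda>y. f \<odot>\<^bsub>M\<^esub> y) ` K" if uv: "u \<in> (\<lambda>y. f \<odot>\<^bsub>M\<^esub> y) ` K" "v \<in> (\<lambda>y. f \<odot>\<^bsub>M\<^esub> y) ` K" for u v
    proof -
      obtain k l where kl: "k \<in> K" "l \<in> K" "u = f \<odot>\<^bsub>M\<^esub> k" "v = f \<odot>\<^bsub>M\<^esub> l" using uv by blast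
      then have "u \<oplus>\<^bsub>M\<^esub> v = f \<odot>\<^bsub>M\<^esub> (k \<oplus>\<^bsub>M\<^esub> l)" using Kc c by (simp add: smult_r_distr)
      then show ?thesis using D(4)[OF kl(1,2)] by blast
    qed
    have smult: "r \<odot>\<^bsub>M\<^esub> u \<in> (\<lambda>y. f \<odot>\<^bsub>M\<^esub> y) ` K" if r: "r \<in> Rc 0" and u: "u \<in> (\<lambda>y. f \<odot>\<^bsub>M\<^esub> y) ` K" for r u
    proof -
      obtain k where k: "k \<in> K" "u = f \<odot>\<^bsub>M\<^esub> k" using u by blast
      then have "r \<odot>\<^bsub>M\<^esub> u = f \<odot>\<^bsub>M\<^esub> (r \<odot>\<^bsub>M\<^esub> k)"
        using Kc c RD.Ac_closed[OF r] by (simp add: smult_assoc1[symmetric] m_comm)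
      then show ?thesis using D(5)[OF r k(1)] by blast
    qed
    have "(\<lambda>y. f \<odot>\<^bsub>M\<^esub> y) ` K \<subseteq> ?L3 (g + t)" using fL2 D(2) by blast
    then show ?thesis using zero add smult by (simp add: degree_submodules_def)
  qed
  have Lg: "L (g + t) \<in> degree_submodules Rc M {\<zero>\<^bsub>M\<^esub>} (?L3 (g + t))"
    by (rule hom_submod_degree[OF L])
      (use hom_submodD(3)[OF L] subset_adjoin[OF L MD.Ac_closed[OF fx]] in auto)
  have "height ?S \<le> height ?T"
  proof (rule height_le_image)
    let ?f = "\<lambda>K. sum_set (L (g + t)) ((\<lambda>y. f \<odot>\<^bsub>M\<^esub> y) ` K)"
    show "?f K \<le> ?f K'" if "K \<le> K'" for K K' using that by (intro sum_set_mono image_mono)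
    have sub: "L (g + t) \<subseteq> ?f K" "(\<lambda>y. f \<odot>\<^bsub>M\<^esub> y) ` K \<subseteq> ?f K" if K: "K \<in> ?S" for K
      using subset_sum_set[of "L (g + t)" "(\<lambda>y. f \<odot>\<^bsub>M\<^esub> y) ` K"]
        degree_submodulesD(2,3)[OF Lg] degree_submodulesD(2,3)[OF image[OF K]] carr(2) by blast+
    show "?f K \<in> ?T" if K: "K \<in> ?S" for K
    proof (rule sum_set_degree_submodules[OF Lg image[OF K] carr(2) carr(2) sub(1)[OF K]])
      show "?f K \<subseteq> ?L3 (g + t)"
        unfolding sum_set_def
        using hom_submodD(4)[OF L3 subsetD[OF degree_submodulesD(2)[OF Lg]]
            subsetD[OF degree_submodulesD(2)[OF image[OF K]]]] by blast
    qed
    show "inj_on ?f ?S"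
    proof (rule inj_onI)
      have *: "K \<subseteq> K'" if K: "K \<in> ?S" and K': "K' \<in> ?S" and eq: "?f K = ?f K'" for K K'
      proof
        fix y assume y: "y \<in> K"
        then have "f \<odot>\<^bsub>M\<^esub> y \<in> ?f K'" using sub(2)[OF K] eq by blast
        then obtain l k where lk: "l \<in> L (g + t)" "k \<in> K'" "f \<odot>\<^bsub>M\<^esub> y = l \<oplus>\<^bsub>M\<^esub> f \<odot>\<^bsub>M\<^esub> k"
          by (auto simp: sum_set_def)
        have L2yk: "y \<in> ?L2 t" "k \<in> ?L2 t" using y lk(2) degree_submodulesD(2) K K' by blast+
        have yk: "y \<in> carrier M" "k \<in> carrier M" "l \<in> carrier M"
          using L2yk carr(1) hom_submodD(2)[OF L lk(1)] by blast+
        have "f \<odot>\<^bsub>M\<^esub> (y \<ominus>\<^bsub>M\<^esub> k) = l"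
          using yk c lk(3) by (simp add: a_minus_def smult_r_distr smult_r_minus M.a_assoc M.r_neg)
        then have "y \<ominus>\<^bsub>M\<^esub> k \<in> L t"
          using injL[OF hom_submod_minus[OF L2 L2yk]] lk(1) by simp
        then have "y \<ominus>\<^bsub>M\<^esub> k \<in> K'" using degree_submodulesD(1)[OF K'] by blast
        then have "(y \<ominus>\<^bsub>M\<^esub> k) \<oplus>\<^bsub>M\<^esub> k \<in> K'" using degree_submodulesD(4)[OF K' _ lk(2)] by blast
        then show "y \<in> K'" using yk by (simp add: a_minus_def M.a_assoc M.l_neg)
      qed
      fix K K' assume "K \<in> ?S" "K' \<in> ?S" "?f K = ?f K'"
      then show "K = K'" using *[of K K'] *[of K' K] by (metis subset_antisym)
    qed
  qed
  moreover have "height ?T \<le> height ?S"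
  proof (rule height_le_image)
    let ?f = "\<lambda>K. {y\<in>?L2 t. f \<odot>\<^bsub>M\<^esub> y \<in> K}"
    show "?f K \<le> ?f K'" if "K \<le> K'" for K K' using that by blast
    show "?f K \<in> ?S" if K: "K \<in> ?T" for K
    proof -
      note D = degree_submodulesD[OF K]
      have "L t \<subseteq> ?f K"
        using subset_adjoin[OF L c(2)] hom_submodD(5)[OF L f] D(1) by blast
      moreover have "\<zero>\<^bsub>M\<^esub> \<in> ?f K" using hom_submodD(3)[OF L2] D(3) c by simp
      moreover have "y \<oplus>\<^bsub>M\<^esub> z \<in> ?f K" if yz: "y \<in> ?f K" "z \<in> ?f K" for y z
      proof -
        have "y \<in> carrier M" "z \<in> carrier M" using yz hom_submodD(2)[OF L2] by blast+
        then show ?thesis using yz hom_submodD(4)[OF L2, of y t z] D(4) c by (simp add: smult_r_distr)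
      qed
      moreover have "r \<odot>\<^bsub>M\<^esub> y \<in> ?f K" if r: "r \<in> Rc 0" and y: "y \<in> ?f K" for r y
      proof -
        have "f \<odot>\<^bsub>M\<^esub> (r \<odot>\<^bsub>M\<^esub> y) = r \<odot>\<^bsub>M\<^esub> (f \<odot>\<^bsub>M\<^esub> y)"
          using y hom_submodD(2)[OF L2, of y t] RD.Ac_closed[OF r] c by (simp add: smult_assoc1[symmetric] m_comm)
        then show ?thesis using hom_submodD(5)[OF L2 r, of y t] D(5)[OF r] y by simp
      qed
      ultimately show ?thesis unfolding degree_submodules_def by blast
    qed
    show "inj_on ?f ?T"
    proof (rule inj_onI)
      have *: "K \<subseteq> K'" if K: "K \<in> ?T" and K': "K' \<in> ?T" and eq: "?f K = ?f K'" for K K'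
      proof
        fix z assume z: "z \<in> K"
        then obtain l r where lr: "l \<in> L (g + t)" "r \<in> Rc (t - d)" "z = l \<oplus>\<^bsub>M\<^esub> r \<odot>\<^bsub>M\<^esub> (f \<odot>\<^bsub>M\<^esub> x)"
          using subsetD[OF degree_submodulesD(2)[OF K] z] by (auto simp: adjoin_def)
        have lK: "l \<in> K" "l \<in> K'" using lr(1) degree_submodulesD(1) K K' by blast+
        have rfx: "r \<odot>\<^bsub>M\<^esub> (f \<odot>\<^bsub>M\<^esub> x) \<in> K"
          by (rule degree_submodules_cancel[OF K carr(2) lK(1)]) (use z lr(3) c RD.Ac_closed[OF lr(2)] in auto)
        have "r \<odot>\<^bsub>M\<^esub> x \<in> ?L2 t"
          using hom_submodD(5)[OF L2 lr(2) mem_adjoin[OF L c(2)]] by simp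
        then have "r \<odot>\<^bsub>M\<^esub> x \<in> ?f K" using rfx swap[OF lr(2)] by simp
        then have "r \<odot>\<^bsub>M\<^esub> x \<in> ?f K'" using eq by blast
        then have "r \<odot>\<^bsub>M\<^esub> (f \<odot>\<^bsub>M\<^esub> x) \<in> K'" using swap[OF lr(2)] by simp
        then show "z \<in> K'" unfolding lr(3) by (rule degree_submodulesD(4)[OF K' lK(2)])
      qed
      fix K K' assume "K \<in> ?T" "K' \<in> ?T" "?f K = ?f K'"
      then show "K = K'" using *[of K K'] *[of K' K] by (metis subset_antisym)
    qed
  qed
  ultimately show ?thesis by (rule antisym)
qed

end

text \<open>The ideal \<open>J\<close> is the induction variable and the subquotient is arbitrary,
  because the smaller problem concerns another subquotient: with L2 = L + Rx and L3 = L + Rfx it is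
  L2/L3, killed by the colon ideal (L3 : x).\<close>

lemma almost_periodic_hilbert_fun:
  fixes R :: "('a, 'm) ring_scheme" and Rc :: "rat ^ 'd \<Rightarrow> 'a set"
    and M :: "('a, 'b, 'n) module_scheme" and Mc :: "rat ^ 'd \<Rightarrow> 'b set"
  assumes graded: "full_graded_module R Rc M Mc"
    and accR: "acc {J. homogeneous_submodule Rc (self_module R) Rc J}"
    and accM: "acc {N. homogeneous_submodule Rc M Mc N}"
    and fin: "\<And>t. height (degree_submodules Rc M {\<zero>\<^bsub>M\<^esub>} (Mc t)) < \<infinity>"
    and J: "homogeneous_submodule Rc (self_module R) Rc J"
    and N: "homogeneous_submodule Rc M Mc N'" "homogeneous_submodule Rc M Mc N" "N' \<le> N"
    and kill: "\<And>g t r x. r \<in> J g \<Longrightarrow> x \<in> N t \<Longrightarrow> r \<odot>\<^bsub>M\<^esub> x \<in> N' (g + t)"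
  shows "almost_periodic (full_graded_module.hilbert_fun Rc M N' N)"
proof -
  interpret full_graded_module R Rc M Mc by (rule graded)
  show ?thesis
    using J N kill
  proof (induction J arbitrary: N' N rule: wf_induct_rule[OF accR[unfolded acc_def]])
    case (1 J)
    note J = "1.prems"(1) and N' = "1.prems"(2) and N = "1.prems"(3) and kill = "1.prems"(5)
    \<comment> \<open>No filtration is built: a maximal \<open>L\<close> up to which the claim holds
      is shown to be all of \<open>N\<close>, since another cyclic step could be added
      otherwise.\<close>
    let ?T = "{L. hom_submod L \<and> N' \<le> L \<and> L \<le> N \<and> almost_periodic (hilbert_fun N' L)}"
    have "almost_periodic (hilbert_fun N' N')"
      by (rule almost_periodic.finite_support) (simp add: hilbert_fun_eq_0)
    then have "N' \<in> ?T" using N' "1.prems"(4) by simp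
    then have ne: "?T \<noteq> {}" by blast
    have "?T \<subseteq> {N. hom_submod N}" by blast
    from acc_maximal[OF accM this ne] obtain L where L0: "L \<in> ?T" "\<forall>K\<in>?T. \<not> L < K" by (rule bexE)
    then have L: "hom_submod L" "N' \<le> L" "L \<le> N" "almost_periodic (hilbert_fun N' L)" by auto
    show ?case
    proof (cases "L = N")
      case True
      then show ?thesis using L(4) by simp
    next
      case False
      obtain d x where x: "x \<in> N d" "x \<notin> L d"
        and prime: "\<And>f g r h. f \<in> Rc g \<Longrightarrow> f \<odot>\<^bsub>M\<^esub> x \<notin> L (g + d) \<Longrightarrow> r \<in> Rc h \<Longrightarrow>
          r \<odot>\<^bsub>M\<^esub> (f \<odot>\<^bsub>M\<^esub> x) \<in> L (h + (g + d)) \<Longrightarrow> r \<odot>\<^bsub>M\<^esub> x \<in> L (h + d)"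
        using exists_prime_colon[OF accR L(1) N L(3) False] by metis
      have xM: "x \<in> Mc d" "x \<in> carrier M" using hom_submodD(1,2)[OF N x(1)] by blast+
      let ?L2 = "adjoin L d x"
      have L2: "hom_submod ?L2" by (rule hom_submod_adjoin[OF L(1) xM(1)])
      have LL2: "L \<le> ?L2" using subset_adjoin[OF L(1) xM(2)] by (simp add: le_fun_def)
      have L2N: "?L2 \<le> N" using adjoin_subset[OF N _ x(1), of L] L(3) by (simp add: le_fun_def)
      have "almost_periodic (hilbert_fun L ?L2)"
      proof (cases "\<exists>g f. g \<noteq> 0 \<and> f \<in> Rc g \<and> f \<odot>\<^bsub>M\<^esub> x \<notin> L (g + d)")
        case True
        then obtain g f where f: "g \<noteq> 0" "f \<in> Rc g" "f \<odot>\<^bsub>M\<^esub> x \<notin> L (g + d)" by blast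
        have fx: "f \<odot>\<^bsub>M\<^esub> x \<in> Mc (g + d)" "f \<odot>\<^bsub>M\<^esub> x \<in> carrier M"
          using smult_mem[OF f(2) xM(1)] MD.Ac_closed by blast+
        let ?L3 = "adjoin L (g + d) (f \<odot>\<^bsub>M\<^esub> x)"
        have L3: "hom_submod ?L3" by (rule hom_submod_adjoin[OF L(1) fx(1)])
        have LL3: "L \<le> ?L3" using subset_adjoin[OF L(1) fx(2)] by (simp add: le_fun_def)
        have fxL2: "f \<odot>\<^bsub>M\<^esub> x \<in> ?L2 (g + d)"
          by (rule hom_submodD(5)[OF L2 f(2) mem_adjoin[OF L(1) xM(2)]])
        have L3L2: "?L3 \<le> ?L2"
          using adjoin_subset[OF L2 _ fxL2, of L] LL2 by (simp add: le_fun_def)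
        let ?J = "colon ?L3 d x"
        have J': "hom_ideal ?J" by (rule hom_ideal_colon[OF L3 xM(2)])
        have "J \<le> ?J"
        proof (intro le_funI subsetI)
          fix h r assume r: "r \<in> J h"
          have "r \<odot>\<^bsub>M\<^esub> x \<in> N' (h + d)" by (rule kill[OF r x(1)])
          then have "r \<odot>\<^bsub>M\<^esub> x \<in> ?L3 (h + d)" using le_funD[OF L(2)] le_funD[OF LL3] by blast
          moreover have "r \<in> Rc h" using r J by (auto simp: homogeneous_submodule_def)
          ultimately show "r \<in> ?J h" by (simp add: colon_def)
        qed
        moreover have "f \<in> ?J g" using f(2) mem_adjoin[OF L(1) fx(2)] by (simp add: colon_def)
        \<comment> \<open>The new ideal is strictly larger: \<open>J\<close> takes \<open>x\<close>
          into \<open>N'\<close>, hence into \<open>L\<close>, whereas \<open>f\<close> does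
          not.\<close>
        moreover have "f \<notin> J g" using kill[OF _ x(1), of f g] f(3) le_funD[OF L(2)] by blast
        ultimately have "J < ?J" by (auto simp: order_less_le)
        then have rel: "(?J, J) \<in> {(y, x). x \<in> {J. hom_ideal J} \<and> y \<in> {J. hom_ideal J} \<and> x < y}"
          using J J' by simp
        have "almost_periodic (hilbert_fun ?L3 ?L2)"
        proof (rule "1.IH"[OF rel J' L3 L2 L3L2])
          fix h t r y assume r: "r \<in> ?J h" and y: "y \<in> ?L2 t"
          have r': "r \<in> Rc h" "r \<odot>\<^bsub>M\<^esub> x \<in> ?L3 (h + d)" using r by (auto simp: colon_def)
          obtain l s where ls: "l \<in> L t" "s \<in> Rc (t - d)" "y = l \<oplus>\<^bsub>M\<^esub> s \<odot>\<^bsub>M\<^esub> x" using y by (auto simp: adjoin_def)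
          have "r \<odot>\<^bsub>M\<^esub> y = r \<odot>\<^bsub>M\<^esub> l \<oplus>\<^bsub>M\<^esub> s \<odot>\<^bsub>M\<^esub> (r \<odot>\<^bsub>M\<^esub> x)"
            using ls(3) hom_submodD(2)[OF L(1) ls(1)] xM(2) RD.Ac_closed[OF r'(1)] RD.Ac_closed[OF ls(2)]
            by (simp add: smult_r_distr smult_assoc1[symmetric] m_comm)
          moreover have "r \<odot>\<^bsub>M\<^esub> l \<in> ?L3 (h + t)"
            using hom_submodD(5)[OF L(1) r'(1) ls(1)] le_funD[OF LL3] by blast
          moreover have "s \<odot>\<^bsub>M\<^esub> (r \<odot>\<^bsub>M\<^esub> x) \<in> ?L3 (h + t)"
            using hom_submodD(5)[OF L3 ls(2) r'(2)] by (simp add: algebra_simps)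
          ultimately show "r \<odot>\<^bsub>M\<^esub> y \<in> ?L3 (h + t)" using hom_submodD(4)[OF L3] by simp
        qed
        \<comment> \<open>Multiplication by \<open>f\<close> equates the length of
          \<open>?L2\<close> over \<open>L\<close> in degree t - g with that of \<open>?L3\<close>
          over \<open>L\<close> in degree t; subtracting leaves the length of \<open>?L2\<close>
          over \<open>?L3\<close>.\<close>
        moreover have "shift_diff g (hilbert_fun L ?L2) = hilbert_fun ?L3 ?L2"
        proof
          fix t
          have "hilbert_fun L ?L2 (t - g) = hilbert_fun L ?L3 t"
            using len_adjoin_multiple[OF L(1) xM(1) f(2) prime[OF f(2,3)], of "t - g"]
            by (simp add: hilbert_fun_def)
          then show "shift_diff g (hilbert_fun L ?L2) t = hilbert_fun ?L3 ?L2 t"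
            using hilbert_fun_add[OF fin L(1) L3 L2 LL3 L3L2, of t] by (simp add: shift_diff_def)
        qed
        ultimately show ?thesis using almost_periodic_rational_step[OF f(1)] by simp
      next
        case False
        have "?L2 t \<subseteq> L t" if "t \<noteq> d" for t
        proof
          fix y assume "y \<in> ?L2 t"
          then obtain l s where ls: "l \<in> L t" "s \<in> Rc (t - d)" "y = l \<oplus>\<^bsub>M\<^esub> s \<odot>\<^bsub>M\<^esub> x" by (auto simp: adjoin_def)
          have "t - d \<noteq> 0" using that by simp
          then have "s \<odot>\<^bsub>M\<^esub> x \<in> L (t - d + d)" using False ls(2) by blast
          then show "y \<in> L t" unfolding ls(3) using hom_submodD(4)[OF L(1) ls(1)] by simp
        qed
        then have "{t. hilbert_fun L ?L2 t \<noteq> 0} \<subseteq> {d}" using hilbert_fun_eq_0 by blast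
        then show ?thesis by (intro almost_periodic.finite_support) (rule finite_subset, auto)
      qed
      moreover have "(\<lambda>t. hilbert_fun N' L t + hilbert_fun L ?L2 t) = hilbert_fun N' ?L2"
        by (rule ext, rule hilbert_fun_add[OF fin N' L(1) L2 L(2) LL2, symmetric])
      ultimately have "almost_periodic (hilbert_fun N' ?L2)"
        using almost_periodic_add[OF L(4), of "hilbert_fun L ?L2"] by simp
      then have "?L2 \<in> ?T" using L2 order_trans[OF L(2) LL2] L2N by simp
      then have "\<not> L < ?L2" using L0(2) by blast
      then have "?L2 = L" using LL2 by (simp add: order_less_le)
      then show ?thesis using x(2) mem_adjoin[OF L(1) xM(2), of d] by simp
    qed
  qed
qed

section \<open>Passage from a grading by a subgroup to one by the whole group\<close>

lemma graded_module_extend_by_zero: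
  assumes G: "is_subgroup G" and gm: "graded_module G R Rc M Mc"
  shows "full_graded_module R (extend_by_zero G R Rc) M (extend_by_zero G M Mc)"
proof -
  interpret graded_module G R Rc M Mc by (rule gm)
  let ?R = "extend_by_zero G R Rc" and ?M = "extend_by_zero G M Mc"
  have sub: "additive_subgroup (Rc g) R" "additive_subgroup (Mc g) M" if "g \<in> G" for g
    using ring_direct_sum module_direct_sum that by (simp_all add: is_direct_sum_def)
  note closed = additive_subgroup.a_Hcarr[OF sub(1)] additive_subgroup.a_Hcarr[OF sub(2)]
    and zero = additive_subgroup.zero_closed[OF sub(1)] additive_subgroup.zero_closed[OF sub(2)]
  have sum: "g + h \<in> G" if "g \<in> G" "h \<in> G" for g h using G that by (auto simp: is_subgroup_def)
  have "graded_ring UNIV R ?R"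
  proof
    show "is_direct_sum UNIV R ?R"
      by (rule is_direct_sum_extend_by_zero[OF _ ring_direct_sum]) (rule is_abelian_group)
    \<comment> \<open>Either both degrees lie in \<open>G\<close>, and then so does their sum, or
      one factor is zero and the product lies in every component.\<close>
    show "a \<otimes>\<^bsub>R\<^esub> b \<in> ?R (g + h)" if "a \<in> ?R g" "b \<in> ?R h" for a b g h
      using that closed zero sum ring_mult_degree
      by (auto simp: extend_by_zero_def split: if_splits)
  qed
  moreover have "graded_module_axioms UNIV ?R M ?M"
  proof
    show "is_direct_sum UNIV M ?M"
      by (rule is_direct_sum_extend_by_zero[OF M.abelian_group_axioms module_direct_sum])
    show "a \<odot>\<^bsub>M\<^esub> b \<in> ?M (g + h)" if "a \<in> ?R g" "b \<in> ?M h" for a b g h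
      using that closed zero sum smult_degree
      by (auto simp: extend_by_zero_def split: if_splits)
  qed
  ultimately show ?thesis
    by (simp add: full_graded_module_def graded_module_def module_axioms)
qed

theorem theorem1p6:
  fixes G :: "(rat ^ 'd) set"
    and R :: "('a, 'm) ring_scheme" and Rc :: "rat ^ 'd \<Rightarrow> 'a set"
    and M :: "('a, 'b, 'n) module_scheme" and Mc :: "rat ^ 'd \<Rightarrow> 'b set"
  assumes "is_subgroup G"
    and "graded_ring G R Rc"
    and "noetherian_ring R"
    and "graded_module G R Rc M Mc"
    and "finitely_generated_module R M"
  shows "(modest G R Rc M Mc \<longleftrightarrow>
            artinian_ring ((R Quot ann R M)\<lparr>carrier := quotient_grading R (ann R M) Rc 0\<rparr>)) \<and>
         (modest G R Rc M Mc \<longrightarrow> summable_series (hilbert_series G R Rc M Mc))"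
proof -
  let ?R = "extend_by_zero G R Rc" and ?M = "extend_by_zero G M Mc"
  interpret full_graded_module R ?R M ?M by (rule graded_module_extend_by_zero[OF assms(1,4)])
  interpret S: full_graded_module R ?R "self_module R" ?R by (rule full_graded_self_module)
  have "0 \<in> G" using assms(1) by (simp add: is_subgroup_def)
  then have R0: "?R 0 = Rc 0" by (simp add: extend_by_zero_def)
  have len_in: "len {\<zero>\<^bsub>M\<^esub>} (?M t) = graded_length R Rc M Mc t" if "t \<in> G" for t
    using graded_length_eq_len[of t] that by (simp add: graded_length_def R0) (simp add: extend_by_zero_def)
  \<comment> \<open>The extended component is zero there, in agreement with the value 0 that
    \<open>hilbert_series\<close> takes outside \<open>G\<close>.\<close>
  have len_out: "len {\<zero>\<^bsub>M\<^esub>} (?M t) = 0" if "t \<notin> G" for t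
    by (rule height_singleton[of _ "{\<zero>\<^bsub>M\<^esub>}"]) (use that in \<open>auto simp: extend_by_zero_def degree_submodules_def\<close>)
  have modest_iff: "modest G R Rc M Mc \<longleftrightarrow> (\<forall>t. len {\<zero>\<^bsub>M\<^esub>} (?M t) < \<infinity>)"
    unfolding modest_def using len_in len_out
    by (metis i0_lb infinity_ne_i0 order_le_less)
  have "quotient_grading R (ann R M) ?R 0 = quotient_grading R (ann R M) Rc 0"
    by (simp add: quotient_grading_def R0)
  then have "modest G R Rc M Mc \<longleftrightarrow>
      artinian_ring ((R Quot ann R M)\<lparr>carrier := quotient_grading R (ann R M) Rc 0\<rparr>)"
    using finite_len_iff_artinian[OF assms(3,5)] modest_iff by simp
  moreover have "summable_series (hilbert_series G R Rc M Mc)" if "modest G R Rc M Mc"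
  proof -
    have fin: "\<And>t. len {\<zero>\<^bsub>M\<^esub>} (?M t) < \<infinity>" using modest_iff that by blast
    have "almost_periodic (hilbert_fun (\<lambda>t. {\<zero>\<^bsub>M\<^esub>}) ?M)"
    \<comment> \<open>The induction is entered at the zero ideal, which kills the whole module
      regarded as a subquotient over the zero submodule.\<close>
    proof (rule almost_periodic_hilbert_fun[OF full_graded_module_axioms
          acc_homogeneous_ideals[OF assms(3)] acc_hom_submod[OF assms(3,5)] fin S.hom_submod_zero
          hom_submod_zero hom_submod_Mc])
      show "(\<lambda>t. {\<zero>\<^bsub>M\<^esub>}) \<le> ?M" using MD.zero_in_Ac by (simp add: le_fun_def)
      show "r \<odot>\<^bsub>M\<^esub> x \<in> {\<zero>\<^bsub>M\<^esub>}" if "r \<in> {\<zero>\<^bsub>self_module R\<^esub>}" "x \<in> ?M t" for r x t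
        using that MD.Ac_closed by simp
    qed
    moreover have "hilbert_fun (\<lambda>t. {\<zero>\<^bsub>M\<^esub>}) ?M = hilbert_series G R Rc M Mc"
      using len_in len_out by (auto simp: hilbert_fun_def hilbert_series_def fun_eq_iff zero_enat_def)
    ultimately show ?thesis using almost_periodic_imp_summable by simp
  qed
  ultimately show ?thesis by blast
qed

end
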